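(* Let $M\ge 0$ be a fixed integer and let the positions $X_1,\dots,X_M$ of the interferers be independent and uniformly distributed over the disk $\mathcal A$ of radius $r_{\mathsf{out}}$ centered at the origin, with common access probability $p_i=p\in[0,1]$ for all $i$. Then for each $j\in\{1,2\}$ the spatially averaged first moment of the conditional outage probability $\epsilon_j(\boldsymbol r)$ is $$\mathbb E_{\boldsymbol r}[\epsilon_j(\boldsymbol r)\mid M]=1-\exp\left(-\frac{\beta}{\mathsf{SNR}}\right)\left[1-p+p\,\mathcal T(r_{\mathsf{out}},r_0)\right]^M,$$ where $$\mathcal T(r_{\mathsf{out}},r_0)=\frac{2\pi r_0^2}{|\mathcal A|\,\beta}\,\Psi\left(\frac{r_{\mathsf{out}}-r_0}{r_0}\right)+\frac{2r_0^2}{|\mathcal A|}\,\mathcal Z_1(r_{\mathsf{out}},r_0),$$ $$\Psi(x)=\int_0^x\frac{r^{\alpha+1}}{1+r^\alpha\beta^{-1}}\,dr=\frac{x^{\alpha+2}}{2+\alpha}\;{}_2F_1\left(1,\tfrac{2}{\alpha}+1;\tfrac{2}{\alpha}+2;-\tfrac{x^\alpha}{\beta}\right),$$ $$\mathcal Z_1(x,y)=\int_{(x-y)/y}^{(x+y)/y}\frac{r^{\alpha+1}}{\beta+r^\alpha}\arccos\left(\frac{y^2r^2+y^2-x^2}{2y^2r}\right)dr .$$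
   Context: Network model. Identify the plane with $\mathbb C$. The network region $\mathcal A$ is the disk of radius $r_{\mathsf{out}}$ centered at $0$, with area $|\mathcal A|=\pi r_{\mathsf{out}}^2$. A reference transmitter is at $X_0=0$; two receivers are at $Y_1=r_0$ and $Y_2=r_0e^{\mathrm{i}\theta}$, where $0<r_0\le r_{\mathsf{out}}$, $\theta\in\mathbb R$. There are $M$ interferers at positions $X_1,\dots,X_M\in\mathcal A$. Put $r_{i,j}=|X_i-Y_j|/r_0$ (normalized distance) and $\boldsymbol r=\{r_{i,j}\}_{1\le i\le M,\,j\in\{1,2\}}$. Constants: path-loss exponent $\alpha>0$, SINR threshold $\beta>0$, $\mathsf{SNR}>0$. The SINR at $Y_j$ is $$\gamma_j=\frac{g_{0,j}}{\mathsf{SNR}^{-1}+\sum_{i=1}^M I_i\,g_{i,j}\,r_{i,j}^{-\alpha}},$$ where the $g_{i,j}$ are i.i.d. unit-mean exponential random variables (Rayleigh fading), the $I_i$ are independent Bernoulli variables with $\mathbb P[I_i=1]=p_i$, and the $g$'s, the $I$'s and the positions are mutually independent. The conditional outage probability is $$\epsilon_j(\boldsymbol r)=\mathbb P[\gamma_j\le\beta\mid\boldsymbol r,M]=1-\exp\left(-\frac{\beta}{\mathsf{SNR}}\right)\prod_{i=1}^M\left(1-p_i+\frac{p_i\,r_{i,j}^\alpha}{\beta+r_{i,j}^\alpha}\right).$$ $\mathbb E_{\boldsymbol r}[\,\cdot\mid M]$ denotes expectation over the interferer positions for the given number $M$. ${}_2F_1$ is the Gauss hypergeometric function. *)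

theory Defs
  imports "HOL-Probability.Probability" "HOL-Complex_Analysis.Complex_Analysis"
begin

text \<open>The Gauss hypergeometric function on the principal sheet: the unique holomorphic function
  on the plane cut along \<open>[1, \<infinity>)\<close> that is the sum of the Gauss series on the unit disk.
  The analytic continuation is needed because the argument \<open>- x\<^sup>\<alpha> / \<beta>\<close> may lie outside that disk.
  Values on the cut itself carry no meaning.\<close>

definition hyp2F1 :: "complex \<Rightarrow> complex \<Rightarrow> complex \<Rightarrow> complex \<Rightarrow> complex" where
  "hyp2F1 a b c z = (THE w. \<exists>F. F holomorphic_on - (complex_of_real ` {1..}) \<and>
     (\<forall>u. norm u < 1 \<longrightarrow>
        (\<lambda>n. pochhammer a n * pochhammer b n / pochhammer c n * u ^ n / fact n) sums F u) \<and>
     w = F z)"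

lemma hyp2F1_eqI:
  assumes hol: "F holomorphic_on - (complex_of_real ` {1..})"
    and ser: "\<And>u. norm u < 1 \<Longrightarrow>
        (\<lambda>n. pochhammer a n * pochhammer b n / pochhammer c n * u ^ n / fact n) sums F u"
    and z: "z \<notin> complex_of_real ` {1..}"
  shows "hyp2F1 a b c z = F z"
proof -
  let ?S = "- (complex_of_real ` {1..})"
  have "closed (complex_of_real ` {1..})"
    by (rule closed_injective_linear_image) (simp_all add: inj_on_def linear_iff scaleR_conv_of_real)
  then have "open ?S" by (simp add: open_Compl)
  moreover have "connected ?S"
    by (rule starlike_imp_connected[OF starlike_slotted_complex_plane_right])
  moreover have "ball 0 1 \<subseteq> ?S"
    by (force simp: dist_norm)
  ultimately have uniq: "G z = F z" if "G holomorphic_on ?S" "\<And>u. norm u < 1 \<Longrightarrow> G u = F u" for G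
    using analytic_continuation_open[of "ball 0 1" ?S G F z] that hol z by simp
  show ?thesis
    unfolding hyp2F1_def
  proof (rule the_equality)
    show "w = F z"
      if ex: "\<exists>G. G holomorphic_on ?S \<and> (\<forall>u. norm u < 1 \<longrightarrow>
        (\<lambda>n. pochhammer a n * pochhammer b n / pochhammer c n * u ^ n / fact n) sums G u) \<and>
        w = G z" for w
    proof -
      from ex obtain G where G: "G holomorphic_on ?S" "w = G z" and "\<forall>u. norm u < 1 \<longrightarrow>
        (\<lambda>n. pochhammer a n * pochhammer b n / pochhammer c n * u ^ n / fact n) sums G u"
        by auto
      then have "G u = F u" if "norm u < 1" for u
        using sums_unique2 ser that by metis
      with uniq[OF G(1)] G(2) show "w = F z" by simp
    qed
  qed (intro exI[of _ F] conjI hol allI impI ser refl)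
qed


definition receiver :: "real \<Rightarrow> real \<Rightarrow> nat \<Rightarrow> complex" where
  "receiver r0 \<theta> j = (if j = 1 then of_real r0 else of_real r0 * cis \<theta>)"

definition norm_dist :: "real \<Rightarrow> real \<Rightarrow> (nat \<Rightarrow> complex) \<Rightarrow> nat \<Rightarrow> nat \<Rightarrow> real" where
  "norm_dist r0 \<theta> x i j = cmod (x i - receiver r0 \<theta> j) / r0"

text \<open>An interferer located exactly at a receiver contributes \<open>0 powr (- \<alpha>) = 0\<close> here rather than
  an infinite interference; for continuously distributed positions this is a null event.\<close>

definition sinr :: "real \<Rightarrow> real \<Rightarrow> nat \<Rightarrow> (nat \<Rightarrow> nat \<Rightarrow> real) \<Rightarrow> (nat \<Rightarrow> bool)
    \<Rightarrow> (nat \<Rightarrow> nat \<Rightarrow> real) \<Rightarrow> nat \<Rightarrow> real" where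
  "sinr \<alpha> SNR M g I r j =
     g 0 j / (1 / SNR + (\<Sum>i = 1..M. of_bool (I i) * g i j * r i j powr (- \<alpha>)))"

text \<open>The \<open>\<sigma>\<close>-algebra generated by the normalized distances, regarded as one random vector
  indexed by \<open>{1..M} \<times> {1, 2}\<close>.\<close>

definition distance_algebra ::
  "'w measure \<Rightarrow> nat \<Rightarrow> real \<Rightarrow> real \<Rightarrow> (nat \<Rightarrow> 'w \<Rightarrow> complex) \<Rightarrow> 'w measure" where
  "distance_algebra P M r0 \<theta> X =
     vimage_algebra (space P)
       (\<lambda>\<omega>. \<lambda>(i, j) \<in> {1..M} \<times> {1, 2}. norm_dist r0 \<theta> (\<lambda>k. X k \<omega>) i j)
       (\<Pi>\<^sub>M k \<in> {1..M} \<times> {1, 2}. borel)"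

definition outage :: "'w measure \<Rightarrow> real \<Rightarrow> real \<Rightarrow> real \<Rightarrow> nat \<Rightarrow> real \<Rightarrow> real
    \<Rightarrow> (nat \<Rightarrow> nat \<Rightarrow> 'w \<Rightarrow> real) \<Rightarrow> (nat \<Rightarrow> 'w \<Rightarrow> bool) \<Rightarrow> (nat \<Rightarrow> 'w \<Rightarrow> complex)
    \<Rightarrow> nat \<Rightarrow> 'w set" where
  "outage P \<alpha> \<beta> SNR M r0 \<theta> g I X j =
     {\<omega> \<in> space P. sinr \<alpha> SNR M (\<lambda>i j. g i j \<omega>) (\<lambda>i. I i \<omega>)
        (norm_dist r0 \<theta> (\<lambda>i. X i \<omega>)) j \<le> \<beta>}"

definition cond_outage_prob :: "'w measure \<Rightarrow> real \<Rightarrow> real \<Rightarrow> real \<Rightarrow> nat \<Rightarrow> real \<Rightarrow> real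
    \<Rightarrow> (nat \<Rightarrow> nat \<Rightarrow> 'w \<Rightarrow> real) \<Rightarrow> (nat \<Rightarrow> 'w \<Rightarrow> bool) \<Rightarrow> (nat \<Rightarrow> 'w \<Rightarrow> complex)
    \<Rightarrow> nat \<Rightarrow> 'w \<Rightarrow> real" where
  "cond_outage_prob P \<alpha> \<beta> SNR M r0 \<theta> g I X j =
     real_cond_exp P (distance_algebra P M r0 \<theta> X)
       (indicator (outage P \<alpha> \<beta> SNR M r0 \<theta> g I X j))"


text \<open>The random inputs take values in three different types, so their joint mutual independence
  is expressed by the independence of the \<open>\<sigma>\<close>-algebras they generate.\<close>

datatype source = Fading nat nat | Access nat | Position nat

fun source_events :: "'w measure \<Rightarrow> (nat \<Rightarrow> nat \<Rightarrow> 'w \<Rightarrow> real) \<Rightarrow> (nat \<Rightarrow> 'w \<Rightarrow> bool)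
    \<Rightarrow> (nat \<Rightarrow> 'w \<Rightarrow> complex) \<Rightarrow> source \<Rightarrow> 'w set set" where
  "source_events P g I X (Fading i j) = sets (vimage_algebra (space P) (g i j) borel)"
| "source_events P g I X (Access i) = sets (vimage_algebra (space P) (I i) (count_space UNIV))"
| "source_events P g I X (Position i) = sets (vimage_algebra (space P) (X i) borel)"

definition sources :: "nat \<Rightarrow> source set" where
  "sources M = {Fading i j | i j. i \<le> M \<and> j \<in> {1, 2}} \<union> Access ` {1..M} \<union> Position ` {1..M}"


definition Psi :: "real \<Rightarrow> real \<Rightarrow> real \<Rightarrow> real" where
  "Psi \<alpha> \<beta> x = integral {0..x} (\<lambda>r. r powr (\<alpha> + 1) / (1 + r powr \<alpha> * inverse \<beta>))"

definition Z1 :: "real \<Rightarrow> real \<Rightarrow> real \<Rightarrow> real \<Rightarrow> real" where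
  "Z1 \<alpha> \<beta> x y = integral {(x - y) / y .. (x + y) / y}
     (\<lambda>r. r powr (\<alpha> + 1) / (\<beta> + r powr \<alpha>) * arccos ((y\<^sup>2 * r\<^sup>2 + y\<^sup>2 - x\<^sup>2) / (2 * y\<^sup>2 * r)))"

definition region_area :: "real \<Rightarrow> real" where
  "region_area r_out = pi * r_out\<^sup>2"

definition T_avg :: "real \<Rightarrow> real \<Rightarrow> real \<Rightarrow> real \<Rightarrow> real" where
  "T_avg \<alpha> \<beta> r_out r0 =
     2 * pi * r0\<^sup>2 / (region_area r_out * \<beta>) * Psi \<alpha> \<beta> ((r_out - r0) / r0)
     + 2 * r0\<^sup>2 / region_area r_out * Z1 \<alpha> \<beta> r_out r0"

end

theory Submission
  imports Defs
begin

text \<open>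
  The expectation of a conditional probability is the unconditional one, so the first claim
  concerns \<open>P(\<gamma>\<^sub>j \<le> \<beta>)\<close>. As \<open>g\<^bsub>0,j\<^esub>\<close> is exponential and independent of the interference, this is one
  minus the Laplace transform of noise plus interference at \<open>\<beta>\<close>, which factors over the
  interferers into terms \<open>1 - p + p E[r\<^sup>\<alpha> / (\<beta> + r\<^sup>\<alpha>)]\<close>. In polar coordinates around the receiver
  the circle of radius \<open>\<rho>\<close> lies in the disk entirely for \<open>\<rho> \<le> r\<^bsub>out\<^esub> - r\<^sub>0\<close>, which gives \<open>\<Psi>\<close>, and up to
  \<open>\<rho> = r\<^bsub>out\<^esub> + r\<^sub>0\<close> in an arc given by the law of cosines, which gives \<open>Z\<^sub>1\<close>. The hypergeometric form of
  \<open>\<Psi>\<close> follows from Euler's integral, which provides the continuation beyond the unit disk, by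
  the substitution \<open>t = (r/x)\<^sup>\<alpha>\<close>.
\<close>

subsection \<open>Polar coordinates in the plane\<close>

text \<open>All averages are computed as nonnegative integrals, so exchanging the order of
  integration asks for measurability only. The price is paid on the way back to the reals:
  \<open>ennreal\<close> truncates negative numbers, so signs such as \<open>0 \<le> T_avg\<close>
  have to be established along with the integrals. Independence is assumed for the sigma-algebras of
  the elementary sources, while the computation needs it for derived quantities such as the
  contribution of one interferer. The link is that each such quantity is measurable with respect to
  the algebra generated by its own block of sources, and disjoint blocks generate independent
  algebras; for a fixed receiver the blocks of different interferers are disjoint. Both receivers
  lie at distance \<open>r0\<close> from the centre of a rotation invariant region, which is why one
  \<open>T_avg\<close> serves both. On the hypergeometric side the parameters are 1,
  \<open>b\<close>, \<open>b + 1\<close> with \<open>b = 2 / \<alpha> + 1\<close>: the binomial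
  factor of Euler's integral is then 1, its constant is \<open>b\<close>, and \<open>b > 1\<close>
  keeps the integrand continuous at 0.\<close>

lemma lborel_eq_distr_Complex:
  "(lborel :: complex measure) = distr (lborel \<Otimes>\<^sub>M lborel) borel (\<lambda>(x, y). Complex x y)"
proof (rule lborel_eqI)
  fix l u :: complex
  assume le: "\<And>b. b \<in> Basis \<Longrightarrow> l \<bullet> b \<le> u \<bullet> b"
  have *: "(\<lambda>(x, y). Complex x y) = (\<lambda>w. of_real (fst w) + \<i> * of_real (snd w))"
    by (auto simp: complex_eq_iff)
  have [measurable]: "(\<lambda>(x, y). Complex x y) \<in> borel_measurable (borel \<Otimes>\<^sub>M borel)"
    unfolding * by measurable
  have "emeasure (distr (lborel \<Otimes>\<^sub>M lborel) borel (\<lambda>(x, y). Complex x y)) (box l u) =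
    emeasure (lborel \<Otimes>\<^sub>M lborel) ({Re l<..<Re u} \<times> {Im l<..<Im u})"
    by (subst emeasure_distr)
      (auto intro!: arg_cong2[where f=emeasure] simp: space_pair_measure mem_box Basis_complex_def)
  also have "\<dots> = ennreal ((Re u - Re l) * (Im u - Im l))"
    using le[of 1] le[of \<i>]
    by (subst lborel.emeasure_pair_measure_Times) (auto simp: ennreal_mult Basis_complex_def)
  also have "\<dots> = ennreal (\<Prod>b\<in>Basis. (u - l) \<bullet> b)"
    by (simp add: Basis_complex_def)
  finally show "emeasure (distr (lborel \<Otimes>\<^sub>M lborel) borel (\<lambda>(x, y). Complex x y)) (box l u) =
    ennreal (\<Prod>b\<in>Basis. (u - l) \<bullet> b)" .
qed simp

text \<open>The substitution u = tan t over the whole line, put as an image measure so that it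
  applies to every nonnegative Borel function at once. By uniqueness of Lebesgue measure only
  intervals have to be checked, and there it is the fundamental theorem of calculus for the
  derivative of tan.\<close>

lemma lborel_eq_distr_tan:
  "(lborel :: real measure) =
    distr (density lborel (\<lambda>t. ennreal (inverse ((cos t)\<^sup>2)) * indicator {-(pi/2)<..<pi/2} t)) borel tan"
    (is "_ = distr ?D _ _")
proof (rule lborel_eqI)
  fix l u :: real
  assume "\<And>b. b \<in> Basis \<Longrightarrow> l \<bullet> b \<le> u \<bullet> b"
  then have le: "l \<le> u" by simp
  have tan_meas [measurable]: "(tan :: real \<Rightarrow> real) \<in> borel_measurable borel"
    unfolding tan_def[abs_def] by measurable
  have set_eq: "tan -` box l u \<inter> {-(pi/2)<..<pi/2} = {arctan l<..<arctan u}"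
  proof (intro equalityI subsetI)
    fix t assume "t \<in> tan -` box l u \<inter> {-(pi/2)<..<pi/2}"
    then have t: "- (pi/2) < t" "t < pi/2" "l < tan t" "tan t < u" by auto
    then have "arctan (tan t) = t" by (intro arctan_tan) auto
    with t show "t \<in> {arctan l<..<arctan u}"
      by (metis arctan_less_iff greaterThanLessThan_iff)
  next
    fix t assume t: "t \<in> {arctan l<..<arctan u}"
    then have b: "- (pi/2) < t" "t < pi/2"
      using arctan_lbound[of l] arctan_ubound[of u] by auto
    then have "arctan (tan t) = t" by (intro arctan_tan) auto
    with t b show "t \<in> tan -` box l u \<inter> {-(pi/2)<..<pi/2}"
      by auto (metis arctan_less_iff)+
  qed
  have "emeasure (distr ?D borel tan) (box l u) =
    (\<integral>\<^sup>+t. ennreal (inverse ((cos t)\<^sup>2)) * indicator {arctan l<..<arctan u} t \<partial>lborel)"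
  proof -
    have "tan -` box l u \<in> sets (borel :: real measure)"
      using measurable_sets_borel[OF tan_meas, of "box l u"] by simp
    then have "emeasure (distr ?D borel tan) (box l u) =
      (\<integral>\<^sup>+t. ennreal (inverse ((cos t)\<^sup>2)) * indicator {-(pi/2)<..<pi/2} t * indicator (tan -` box l u) t \<partial>lborel)"
      by (simp add: emeasure_distr emeasure_density del: box_real)
    then show ?thesis
      unfolding set_eq[symmetric] by (simp add: indicator_inter_arith mult_ac)
  qed
  \<comment> \<open>The endpoints form a null set; the fundamental theorem is applied on a closed
    interval.\<close>
  also have "\<dots> = (\<integral>\<^sup>+t. ennreal (inverse ((cos t)\<^sup>2)) * indicator {arctan l..arctan u} t \<partial>lborel)"
  proof (rule nn_integral_cong_AE)
    show "AE t in lborel. ennreal (inverse ((cos t)\<^sup>2)) * indicator {arctan l<..<arctan u} t =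
      ennreal (inverse ((cos t)\<^sup>2)) * indicator {arctan l..arctan u} t"
      using AE_lborel_singleton[of "arctan l"] AE_lborel_singleton[of "arctan u"]
      by eventually_elim (auto simp: indicator_def)
  qed
  also have "\<dots> = ennreal (tan (arctan u) - tan (arctan l))"
  proof (rule nn_integral_FTC_Icc)
    fix t assume "t \<in> {arctan l..arctan u}"
    then have "- (pi/2) < t" "t < pi/2"
      using arctan_lbound[of l] arctan_ubound[of u] by auto
    then have "cos t \<noteq> 0" using cos_gt_zero_pi by fastforce
    then show "(tan has_real_derivative inverse ((cos t)\<^sup>2)) (at t)"
      by (rule DERIV_tan)
  qed (use le in \<open>auto simp: arctan_le_iff\<close>)
  also have "\<dots> = ennreal (\<Prod>b\<in>Basis. (u - l) \<bullet> b)" by (simp add: tan_arctan)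
  finally show "emeasure (distr ?D borel tan) (box l u) = ennreal (\<Prod>b\<in>Basis. (u - l) \<bullet> b)" .
qed simp

lemma nn_integral_tan:
  fixes f :: "real \<Rightarrow> ennreal"
  assumes [measurable]: "f \<in> borel_measurable borel"
  shows "(\<integral>\<^sup>+u. f u \<partial>lborel) =
    (\<integral>\<^sup>+t. ennreal (inverse ((cos t)\<^sup>2)) * indicator {-(pi/2)<..<pi/2} t * f (tan t) \<partial>lborel)"
proof -
  have [measurable]: "(tan :: real \<Rightarrow> real) \<in> borel_measurable borel"
    unfolding tan_def[abs_def] by measurable
  show ?thesis
    by (subst lborel_eq_distr_tan) (simp add: nn_integral_distr nn_integral_density)
qed

lemma measurable_Complex [measurable]:
  assumes [measurable]: "f \<in> borel_measurable N" "g \<in> borel_measurable N"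
  shows "(\<lambda>x. Complex (f x) (g x)) \<in> borel_measurable N"
  unfolding Complex_eq by measurable

text \<open>Substitute \<open>y = x tan t\<close> for fixed \<open>x\<close>, exchange the integrals, then put \<open>x = r cos t\<close>: only
  one-dimensional changes of variables are needed.\<close>

lemma nn_integral_polar_half_plane:
  fixes f :: "complex \<Rightarrow> ennreal"
  assumes [measurable]: "f \<in> borel_measurable borel"
  shows "(\<integral>\<^sup>+z. indicator {z. 0 < Re z} z * f z \<partial>lborel) =
    (\<integral>\<^sup>+t. indicator {-(pi/2)<..<pi/2} t *
      (\<integral>\<^sup>+r. indicator {0<..} r * ennreal r * f (of_real r * cis t) \<partial>lborel) \<partial>lborel)"
proof -
  have [measurable]: "(tan :: real \<Rightarrow> real) \<in> borel_measurable borel"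
    unfolding tan_def[abs_def] by measurable
  let ?w = "\<lambda>t::real. ennreal (inverse ((cos t)\<^sup>2)) * indicator {-(pi/2)<..<pi/2} t"
  have "(\<integral>\<^sup>+z. indicator {z. 0 < Re z} z * f z \<partial>lborel) =
    (\<integral>\<^sup>+x. (\<integral>\<^sup>+y. indicator {0<..} x * f (Complex x y) \<partial>lborel) \<partial>lborel)"
  proof -
    have "(\<integral>\<^sup>+z. indicator {z. 0 < Re z} z * f z \<partial>lborel) =
      (\<integral>\<^sup>+w. indicator {0<..} (fst w) * f (Complex (fst w) (snd w)) \<partial>(lborel \<Otimes>\<^sub>M lborel))"
      by (subst lborel_eq_distr_Complex, subst nn_integral_distr)
        (simp_all add: case_prod_unfold indicator_def)
    also have "\<dots> = (\<integral>\<^sup>+x. (\<integral>\<^sup>+y. indicator {0<..} x * f (Complex x y) \<partial>lborel) \<partial>lborel)"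
      by (subst lborel.nn_integral_fst[symmetric]) simp_all
    finally show ?thesis .
  qed
  also have "\<dots> = (\<integral>\<^sup>+x. (\<integral>\<^sup>+t. indicator {0<..} x * ennreal x * (?w t * f (Complex x (x * tan t))) \<partial>lborel) \<partial>lborel)"
  proof (rule nn_integral_cong)
    fix x :: real
    show "(\<integral>\<^sup>+y. indicator {0<..} x * f (Complex x y) \<partial>lborel) =
      (\<integral>\<^sup>+t. indicator {0<..} x * ennreal x * (?w t * f (Complex x (x * tan t))) \<partial>lborel)"
    proof (cases "0 < x")
      case True
      have "(\<integral>\<^sup>+y. f (Complex x y) \<partial>lborel) = ennreal x * (\<integral>\<^sup>+y. f (Complex x (x * y)) \<partial>lborel)"
        using True by (subst nn_integral_real_affine[where c=x and t=0]) simp_all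
      also have "(\<integral>\<^sup>+y. f (Complex x (x * y)) \<partial>lborel) =
        (\<integral>\<^sup>+t. ?w t * f (Complex x (x * tan t)) \<partial>lborel)"
        by (rule nn_integral_tan) measurable
      also have "ennreal x * \<dots> = (\<integral>\<^sup>+t. ennreal x * (?w t * f (Complex x (x * tan t))) \<partial>lborel)"
        by (rule nn_integral_cmult[symmetric]) measurable
      finally show ?thesis using True by simp
    qed simp
  qed
  also have "\<dots> = (\<integral>\<^sup>+t. (\<integral>\<^sup>+x. indicator {0<..} x * ennreal x * (?w t * f (Complex x (x * tan t))) \<partial>lborel) \<partial>lborel)"
    by (rule lborel_pair.Fubini') measurable
  also have "\<dots> = (\<integral>\<^sup>+t. indicator {-(pi/2)<..<pi/2} t *
      (\<integral>\<^sup>+r. indicator {0<..} r * ennreal r * f (of_real r * cis t) \<partial>lborel) \<partial>lborel)"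
  proof (rule nn_integral_cong)
    fix t :: real
    show "(\<integral>\<^sup>+x. indicator {0<..} x * ennreal x * (?w t * f (Complex x (x * tan t))) \<partial>lborel) =
      indicator {-(pi/2)<..<pi/2} t *
      (\<integral>\<^sup>+r. indicator {0<..} r * ennreal r * f (of_real r * cis t) \<partial>lborel)"
    proof (cases "t \<in> {-(pi/2)<..<pi/2}")
      case True
      then have c: "0 < cos t" by (intro cos_gt_zero_pi) auto
      have "(\<integral>\<^sup>+x. indicator {0<..} x * ennreal x * (?w t * f (Complex x (x * tan t))) \<partial>lborel) =
        ennreal (cos t) * (\<integral>\<^sup>+r. indicator {0<..} (cos t * r) * ennreal (cos t * r) *
          (?w t * f (Complex (cos t * r) (cos t * r * tan t))) \<partial>lborel)"
        using c by (subst nn_integral_real_affine[where c="cos t" and t=0]) simp_all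
      also have "\<dots> = (\<integral>\<^sup>+r. ennreal (cos t) * (indicator {0<..} (cos t * r) * ennreal (cos t * r) *
          (?w t * f (Complex (cos t * r) (cos t * r * tan t)))) \<partial>lborel)"
        by (rule nn_integral_cmult[symmetric]) simp
      also have "\<dots> = (\<integral>\<^sup>+r. indicator {0<..} r * ennreal r * f (of_real r * cis t) \<partial>lborel)"
      proof (rule nn_integral_cong)
        fix r :: real
        have e: "Complex (cos t * r) (cos t * r * tan t) = of_real r * cis t"
          using c by (simp add: complex_eq_iff tan_def)
        \<comment> \<open>Three factors combine to the polar Jacobian \<open>r\<close>:
          \<open>cos t\<close> from x = r cos t, the scaling factor x = r cos t from y = x u, and 1
          / cos^2 t from u = tan t.\<close>
        have "ennreal (cos t) * (ennreal (cos t * r) * ennreal (inverse ((cos t)\<^sup>2))) = ennreal r" if "0 < r"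
          using c that by (simp add: ennreal_mult[symmetric] power2_eq_square field_simps)
        then show "ennreal (cos t) * (indicator {0<..} (cos t * r) * ennreal (cos t * r) *
          (?w t * f (Complex (cos t * r) (cos t * r * tan t)))) =
          indicator {0<..} r * ennreal r * f (of_real r * cis t)"
          unfolding e using c True
          by (cases "0 < r") (simp_all add: zero_less_mult_iff mult.assoc[symmetric])
      qed
      finally show ?thesis using True by simp
    qed simp
  qed
  finally show ?thesis .
qed

lemma measurable_cis [measurable]: "cis \<in> borel_measurable borel"
  by (intro borel_measurable_continuous_onI continuous_intros)

text \<open>By periodicity the starting angle \<open>d\<close> can be moved by whole turns into the
  window that starts at \<open>c\<close>; the part that then sticks out at the end of this window is
  turned back to its beginning. Half-open windows fit together without overlap.\<close>

lemma nn_integral_circle_shift: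
  fixes f :: "complex \<Rightarrow> ennreal"
  assumes [measurable]: "f \<in> borel_measurable borel"
  shows "(\<integral>\<^sup>+t. indicator {c..<c + 2 * pi} t * f (cis t) \<partial>lborel) =
    (\<integral>\<^sup>+t. indicator {d..<d + 2 * pi} t * f (cis t) \<partial>lborel)"
proof -
  define J where "J = (\<lambda>a b. \<integral>\<^sup>+t. indicator {a..<b} t * f (cis t) \<partial>lborel)"
  have shift: "J (a + 2 * pi * of_int k) (b + 2 * pi * of_int k) = J a b" for a b and k :: int
  proof -
    have per: "cis (2 * pi * of_int k + t) = cis t" for t
      by (simp add: cis_mult[symmetric] cis_multiple_2pi)
    have "J (a + 2 * pi * of_int k) (b + 2 * pi * of_int k) =
      (\<integral>\<^sup>+t. indicator {a + 2 * pi * of_int k..<b + 2 * pi * of_int k} (2 * pi * of_int k + 1 * t) *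
        f (cis (2 * pi * of_int k + 1 * t)) \<partial>lborel)"
      unfolding J_def
      by (subst nn_integral_real_affine[where c=1 and t="2 * pi * of_int k"]) simp_all
    also have "\<dots> = J a b"
      unfolding J_def by (intro nn_integral_cong) (auto simp: per indicator_def)
    finally show ?thesis .
  qed
  have split: "J a b + J b e = J a e" if "a \<le> b" "b \<le> e" for a b e
  proof -
    have "J a b + J b e =
      (\<integral>\<^sup>+t. indicator {a..<b} t * f (cis t) + indicator {b..<e} t * f (cis t) \<partial>lborel)"
      unfolding J_def by (rule nn_integral_add[symmetric]) measurable
    also have "\<dots> = J a e"
      unfolding J_def using that by (intro nn_integral_cong) (auto simp: indicator_def)
    finally show ?thesis .
  qed
  \<comment> \<open>The ceiling is the number of turns that brings the starting angle into the
    interval from \<open>c\<close> to \<open>c + 2 * pi\<close>.\<close>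
  define k where "k = \<lceil>(c - d) / (2 * pi)\<rceil>"
  define e where "e = d + 2 * pi * of_int k"
  have "(c - d) / (2 * pi) \<le> of_int k" "of_int k < (c - d) / (2 * pi) + 1"
    unfolding k_def by linarith+
  then have e: "c \<le> e" "e \<le> c + 2 * pi"
    unfolding e_def by (simp_all add: field_simps)
  have "J d (d + 2 * pi) = J e (e + 2 * pi)"
    using shift[of d k "d + 2 * pi"] by (simp add: e_def add_ac)
  also have "\<dots> = J e (c + 2 * pi) + J (c + 2 * pi) (e + 2 * pi)"
    using e by (intro split[symmetric]) auto
  also have "J (c + 2 * pi) (e + 2 * pi) = J c e"
    using shift[of c 1 e] by simp
  also have "J e (c + 2 * pi) + J c e = J c (c + 2 * pi)"
    using split[of c e "c + 2 * pi"] e by (simp add: add.commute)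
  finally show ?thesis unfolding J_def ..
qed

lemma AE_lborel_Re_neq_0: "AE z in lborel. Re z \<noteq> 0"
proof -
  have [measurable]: "(\<lambda>w. Complex (fst w) (snd w)) \<in> borel_measurable (lborel \<Otimes>\<^sub>M lborel)"
    by measurable
  have fst_eq: "{w. fst w = 0} = {0 :: real} \<times> (UNIV :: real set)" by auto
  have "emeasure lborel {z. Re z = 0} = emeasure (lborel \<Otimes>\<^sub>M lborel) ({0 :: real} \<times> (UNIV :: real set))"
    by (subst lborel_eq_distr_Complex, subst emeasure_distr)
      (auto simp: case_prod_unfold space_pair_measure fst_eq intro!: arg_cong2[where f=emeasure])
  also have "\<dots> = 0"
    by (subst lborel.emeasure_pair_measure_Times) auto
  finally show ?thesis
    by (subst AE_iff_measurable[OF _ refl]) auto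
qed

lemma nn_integral_lborel_uminus:
  fixes f :: "'a::euclidean_space \<Rightarrow> ennreal"
  assumes [measurable]: "f \<in> borel_measurable borel"
  shows "(\<integral>\<^sup>+x. f x \<partial>lborel) = (\<integral>\<^sup>+x. f (- x) \<partial>lborel)"
  by (subst lborel_affine_euclidean[where c = "\<lambda>_. -1" and t = 0])
     (simp_all add: nn_integral_distr nn_integral_density sum_negf euclidean_representation)

lemma nn_integral_lborel_translate:
  fixes f :: "'a::euclidean_space \<Rightarrow> ennreal"
  assumes [measurable]: "f \<in> borel_measurable borel"
  shows "(\<integral>\<^sup>+x. f x \<partial>lborel) = (\<integral>\<^sup>+x. f (a + x) \<partial>lborel)"
  by (subst lborel_distr_plus[of a, symmetric]) (simp add: nn_integral_distr)

text \<open>The plane is the right half-plane, its reflection through 0, and the imaginary axis,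
  which is null. The starting angle \<open>c\<close> is left free so that a window can later be
  centred at the direction of a receiver.\<close>

lemma nn_integral_polar:
  fixes f :: "complex \<Rightarrow> ennreal"
  assumes [measurable]: "f \<in> borel_measurable borel"
  shows "(\<integral>\<^sup>+z. f z \<partial>lborel) =
    (\<integral>\<^sup>+r. indicator {0<..} r * ennreal r *
      (\<integral>\<^sup>+t. indicator {c..<c + 2 * pi} t * f (of_real r * cis t) \<partial>lborel) \<partial>lborel)"
proof -
  define D where "D = (\<lambda>a b r. \<integral>\<^sup>+t. indicator {a<..<b} t * f (of_real r * cis t) \<partial>lborel)"
  \<comment> \<open>Used with \<open>u = 1\<close> for the right half-plane and
    \<open>u = - 1\<close> for the reflected left one.\<close>
  have half: "(\<integral>\<^sup>+z. indicator {z. 0 < Re z} z * f (u * z) \<partial>lborel) =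
    (\<integral>\<^sup>+r. indicator {0<..} r * ennreal r *
      (\<integral>\<^sup>+t. indicator {-(pi/2)<..<pi/2} t * f (u * (of_real r * cis t)) \<partial>lborel) \<partial>lborel)" for u
  proof -
    have "(\<integral>\<^sup>+z. indicator {z. 0 < Re z} z * f (u * z) \<partial>lborel) =
      (\<integral>\<^sup>+t. (\<integral>\<^sup>+r. indicator {-(pi/2)<..<pi/2} t *
        (indicator {0<..} r * ennreal r * f (u * (of_real r * cis t))) \<partial>lborel) \<partial>lborel)"
      by (subst nn_integral_polar_half_plane) (simp_all add: nn_integral_cmult)
    also have "\<dots> = (\<integral>\<^sup>+r. (\<integral>\<^sup>+t. indicator {-(pi/2)<..<pi/2} t *
        (indicator {0<..} r * ennreal r * f (u * (of_real r * cis t))) \<partial>lborel) \<partial>lborel)"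
      by (rule lborel_pair.Fubini') measurable
    also have "\<dots> = (\<integral>\<^sup>+r. indicator {0<..} r * ennreal r *
      (\<integral>\<^sup>+t. indicator {-(pi/2)<..<pi/2} t * f (u * (of_real r * cis t)) \<partial>lborel) \<partial>lborel)"
      by (intro nn_integral_cong) (simp add: nn_integral_cmult[symmetric] mult_ac)
    finally show ?thesis .
  qed
  have reflect: "(\<integral>\<^sup>+z. indicator {z. Re z < 0} z * f z \<partial>lborel) =
    (\<integral>\<^sup>+z. indicator {z. 0 < Re z} z * f (- 1 * z) \<partial>lborel)"
  proof -
    have "(\<integral>\<^sup>+z. indicator {z. Re z < 0} z * f z \<partial>lborel) =
      (\<integral>\<^sup>+z. indicator {z. Re z < 0} (- z) * f (- z) \<partial>lborel)"
      by (rule nn_integral_lborel_uminus) measurable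
    also have "\<dots> = (\<integral>\<^sup>+z. indicator {z. 0 < Re z} z * f (- 1 * z) \<partial>lborel)"
      by (intro nn_integral_cong) (auto simp: indicator_def)
    finally show ?thesis .
  qed
  have "(\<integral>\<^sup>+z. f z \<partial>lborel) =
    (\<integral>\<^sup>+z. indicator {z. 0 < Re z} z * f z + indicator {z. Re z < 0} z * f z \<partial>lborel)"
    using AE_lborel_Re_neq_0
    by (intro nn_integral_cong_AE, eventually_elim) (auto simp: indicator_def)
  also have "\<dots> = (\<integral>\<^sup>+z. indicator {z. 0 < Re z} z * f (1 * z) \<partial>lborel) +
      (\<integral>\<^sup>+z. indicator {z. 0 < Re z} z * f (- 1 * z) \<partial>lborel)"
    unfolding reflect[symmetric] mult_1 by (rule nn_integral_add) measurable
  also have "\<dots> = (\<integral>\<^sup>+r. indicator {0<..} r * ennreal r *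
      ((\<integral>\<^sup>+t. indicator {-(pi/2)<..<pi/2} t * f (1 * (of_real r * cis t)) \<partial>lborel) +
       (\<integral>\<^sup>+t. indicator {-(pi/2)<..<pi/2} t * f (- 1 * (of_real r * cis t)) \<partial>lborel)) \<partial>lborel)"
    unfolding half by (subst nn_integral_add[symmetric]) (simp_all add: distrib_left)
  also have "\<dots> = (\<integral>\<^sup>+r. indicator {0<..} r * ennreal r *
      (\<integral>\<^sup>+t. indicator {c..<c + 2 * pi} t * f (of_real r * cis t) \<partial>lborel) \<partial>lborel)"
  proof (rule nn_integral_cong)
    fix r :: real
    have "(\<integral>\<^sup>+t. indicator {-(pi/2)<..<pi/2} t * f (- 1 * (of_real r * cis t)) \<partial>lborel) =
      (\<integral>\<^sup>+t. indicator {pi/2<..<3*pi/2} (pi + 1 * t) * f (of_real r * cis (pi + 1 * t)) \<partial>lborel)"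
      by (intro nn_integral_cong) (auto simp: cis_mult[symmetric] indicator_def)
    also have "\<dots> = (\<integral>\<^sup>+t. indicator {pi/2<..<3*pi/2} t * f (of_real r * cis t) \<partial>lborel)"
      by (subst (2) nn_integral_real_affine[where c=1 and t=pi]) simp_all
    finally have "(\<integral>\<^sup>+t. indicator {-(pi/2)<..<pi/2} t * f (1 * (of_real r * cis t)) \<partial>lborel) +
       (\<integral>\<^sup>+t. indicator {-(pi/2)<..<pi/2} t * f (- 1 * (of_real r * cis t)) \<partial>lborel) =
       (\<integral>\<^sup>+t. indicator {-(pi/2)<..<pi/2} t * f (of_real r * cis t) +
         indicator {pi/2<..<3*pi/2} t * f (of_real r * cis t) \<partial>lborel)"
      by (simp add: nn_integral_add)
    \<comment> \<open>The two open windows of length pi leave out only the directions of the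
      imaginary axis.\<close>
    also have "\<dots> = (\<integral>\<^sup>+t. indicator {-(pi/2)..<-(pi/2) + 2*pi} t * f (of_real r * cis t) \<partial>lborel)"
      using AE_lborel_singleton[of "-(pi/2)"] AE_lborel_singleton[of "pi/2"]
      by (intro nn_integral_cong_AE, eventually_elim) (auto simp: indicator_def)
    also have "\<dots> = (\<integral>\<^sup>+t. indicator {c..<c + 2 * pi} t * f (of_real r * cis t) \<partial>lborel)"
      by (rule nn_integral_circle_shift[where f = "\<lambda>z. f (of_real r * z)"]) measurable
    finally show "indicator {0<..} r * ennreal r *
      ((\<integral>\<^sup>+t. indicator {-(pi/2)<..<pi/2} t * f (1 * (of_real r * cis t)) \<partial>lborel) +
       (\<integral>\<^sup>+t. indicator {-(pi/2)<..<pi/2} t * f (- 1 * (of_real r * cis t)) \<partial>lborel)) =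
      indicator {0<..} r * ennreal r *
      (\<integral>\<^sup>+t. indicator {c..<c + 2 * pi} t * f (of_real r * cis t) \<partial>lborel)" by simp
  qed
  finally show ?thesis .
qed

section \<open>Angular measure of the part of a circle that lies inside the disk\<close>

lemma emeasure_cos_le:
  assumes "-1 \<le> k" "k \<le> 1"
  shows "emeasure lborel {t \<in> {-pi..<pi}. cos t \<le> k} = ennreal (2 * arccos (- k))"
proof -
  have a: "0 \<le> arccos k" "arccos k \<le> pi"
    using assms by (auto intro: arccos_lbound arccos_ubound)
  have cos_iff: "cos t \<le> k \<longleftrightarrow> arccos k \<le> \<bar>t\<bar>" if "t \<in> {-pi..<pi}" for t
    using cos_mono_le_eq[of "\<bar>t\<bar>" "arccos k"] a that assms by (simp add: abs_le_iff)
  have "{t \<in> {-pi..<pi}. cos t \<le> k} = {-pi..<pi} - {- arccos k<..<arccos k}"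
    using cos_iff by force
  also have "emeasure lborel \<dots> = ennreal (2 * pi) - ennreal (2 * arccos k)"
    using a by (subst emeasure_Diff) auto
  \<comment> \<open>Removing the symmetric arc where cos exceeds \<open>k\<close> leaves 2 pi - 2
    arccos k; the reflection formula of arccos gives the shape used in \<open>Z1\<close>.\<close>
  also have "\<dots> = ennreal (2 * arccos (- k))"
    using a assms by (simp add: ennreal_minus arccos_minus)
  finally show ?thesis .
qed

text \<open>After moving the origin to the receiver, the angular window is started at
  \<open>\<phi> - pi\<close>, so that measuring angles from the direction \<open>\<phi>\<close>
  turns it into the window from -pi to pi. The rotation \<open>cis \<phi>\<close> then drops out of
  the modulus, and the result does not depend on the receiver's direction.\<close>

lemma nn_integral_disk_radial:
  fixes h :: "real \<Rightarrow> ennreal"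
  assumes [measurable]: "h \<in> borel_measurable borel"
  shows "(\<integral>\<^sup>+z. indicator (cball 0 R) z * h (cmod (z - of_real r0 * cis \<phi>)) \<partial>lborel) =
    (\<integral>\<^sup>+r. indicator {0<..} r * ennreal r * h r *
      emeasure lborel {t \<in> {-pi..<pi}. cmod (of_real r0 + of_real r * cis t) \<le> R} \<partial>lborel)"
proof -
  let ?Y = "of_real r0 * cis \<phi>"
  have [measurable]: "cball (0 :: complex) R \<in> sets borel" by simp
  have "(\<integral>\<^sup>+z. indicator (cball 0 R) z * h (cmod (z - ?Y)) \<partial>lborel) =
    (\<integral>\<^sup>+z. indicator (cball 0 R) (?Y + z) * h (cmod (?Y + z - ?Y)) \<partial>lborel)"
    by (rule nn_integral_lborel_translate) measurable
  also have "\<dots> = (\<integral>\<^sup>+z. indicator (cball 0 R) (?Y + z) * h (cmod z) \<partial>lborel)"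
    by simp
  also have "\<dots> = (\<integral>\<^sup>+r. indicator {0<..} r * ennreal r *
      (\<integral>\<^sup>+t. indicator {\<phi> - pi..<\<phi> - pi + 2 * pi} t *
        (indicator (cball 0 R) (?Y + of_real r * cis t) * h (cmod (of_real r * cis t))) \<partial>lborel) \<partial>lborel)"
    by (rule nn_integral_polar) measurable
  also have "\<dots> = (\<integral>\<^sup>+r. indicator {0<..} r * ennreal r * h r *
      emeasure lborel {t \<in> {-pi..<pi}. cmod (of_real r0 + of_real r * cis t) \<le> R} \<partial>lborel)"
  proof (rule nn_integral_cong)
    fix r :: real
    have "(\<integral>\<^sup>+t. indicator {\<phi> - pi..<\<phi> - pi + 2 * pi} t *
        (indicator (cball 0 R) (?Y + of_real r * cis t) * h (cmod (of_real r * cis t))) \<partial>lborel) =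
      (\<integral>\<^sup>+t. indicator {\<phi> - pi..<\<phi> - pi + 2 * pi} (\<phi> + 1 * t) *
        (indicator (cball 0 R) (?Y + of_real r * cis (\<phi> + 1 * t)) * h (cmod (of_real r * cis (\<phi> + 1 * t)))) \<partial>lborel)"
      by (subst nn_integral_real_affine[where c=1 and t=\<phi>]) simp_all
    \<comment> \<open>This inner identity covers every real \<open>r\<close>, hence the absolute
      value; the indicator of positive radii removes it afterwards.\<close>
    also have "\<dots> = (\<integral>\<^sup>+t. h \<bar>r\<bar> *
        indicator {t \<in> {-pi..<pi}. cmod (of_real r0 + of_real r * cis t) \<le> R} t \<partial>lborel)"
    proof (rule nn_integral_cong)
      fix t
      have "?Y + of_real r * cis (\<phi> + 1 * t) = cis \<phi> * (of_real r0 + of_real r * cis t)"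
        by (simp add: cis_mult[symmetric] algebra_simps)
      then have "cmod (?Y + of_real r * cis (\<phi> + 1 * t)) = cmod (of_real r0 + of_real r * cis t)"
        by (simp add: norm_mult)
      then show "indicator {\<phi> - pi..<\<phi> - pi + 2 * pi} (\<phi> + 1 * t) *
        (indicator (cball 0 R) (?Y + of_real r * cis (\<phi> + 1 * t)) * h (cmod (of_real r * cis (\<phi> + 1 * t)))) =
        h \<bar>r\<bar> * indicator {t \<in> {-pi..<pi}. cmod (of_real r0 + of_real r * cis t) \<le> R} t"
        by (auto simp: indicator_def norm_mult)
    qed
    also have "\<dots> = h \<bar>r\<bar> * emeasure lborel {t \<in> {-pi..<pi}. cmod (of_real r0 + of_real r * cis t) \<le> R}"
      by (rule nn_integral_cmult_indicator) measurable
    finally show "indicator {0<..} r * ennreal r *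
      (\<integral>\<^sup>+t. indicator {\<phi> - pi..<\<phi> - pi + 2 * pi} t *
        (indicator (cball 0 R) (?Y + of_real r * cis t) * h (cmod (of_real r * cis t))) \<partial>lborel) =
      indicator {0<..} r * ennreal r * h r *
      emeasure lborel {t \<in> {-pi..<pi}. cmod (of_real r0 + of_real r * cis t) \<le> R}"
      by (simp add: indicator_def mult.assoc)
  qed
  finally show ?thesis .
qed

lemma cmod_add_cis_le_iff:
  assumes "0 < r0" "0 < r" "0 \<le> R"
  shows "cmod (of_real r0 + of_real r * cis t) \<le> R \<longleftrightarrow> cos t \<le> (R\<^sup>2 - r0\<^sup>2 - r\<^sup>2) / (2 * r0 * r)"
proof -
  have "cmod (of_real r0 + of_real r * cis t) ^ 2 = r0\<^sup>2 + r\<^sup>2 + 2 * r0 * r * cos t"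
  proof -
    have "cmod (of_real r0 + of_real r * cis t) ^ 2 = (r0 + r * cos t)\<^sup>2 + (r * sin t)\<^sup>2"
      by (simp add: cmod_power2)
    also have "\<dots> = r0\<^sup>2 + r\<^sup>2 * ((cos t)\<^sup>2 + (sin t)\<^sup>2) + 2 * r0 * r * cos t"
      by (simp only: power2_sum power_mult_distrib distrib_left)
    finally show ?thesis by simp
  qed
  moreover have "cmod (of_real r0 + of_real r * cis t) \<le> R \<longleftrightarrow> cmod (of_real r0 + of_real r * cis t) ^ 2 \<le> R\<^sup>2"
    using assms(3) by (simp add: abs_le_square_iff[symmetric])
  ultimately show ?thesis
    using assms by (simp add: pos_le_divide_eq algebra_simps)
qed

text \<open>The angle is measured from the outward direction at the receiver, so the disk is the
  side where cos is at most \<open>k\<close>. The thresholds \<open>1 \<le> k\<close> and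
  \<open>-1 \<le> k\<close> complete to the squares of \<open>r + r0\<close> and
  \<open>r - r0\<close> being at most that of \<open>R\<close>; since the receiver lies in the disk,
  the second amounts to \<open>r \<le> R + r0\<close>.\<close>

lemma emeasure_arc:
  assumes r: "0 < r0" "0 < r" "r0 \<le> R"
  shows "emeasure lborel {t \<in> {-pi..<pi}. cmod (of_real r0 + of_real r * cis t) \<le> R} =
    (if r \<le> R - r0 then ennreal (2 * pi)
     else if r \<le> R + r0 then ennreal (2 * arccos ((r\<^sup>2 + r0\<^sup>2 - R\<^sup>2) / (2 * r0 * r)))
     else 0)"
proof -
  define k where "k = (R\<^sup>2 - r0\<^sup>2 - r\<^sup>2) / (2 * r0 * r)"
  have iff: "cmod (of_real r0 + of_real r * cis t) \<le> R \<longleftrightarrow> cos t \<le> k" for t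
    unfolding k_def using r by (intro cmod_add_cis_le_iff) auto
  have k_ge: "1 \<le> k \<longleftrightarrow> r \<le> R - r0"
  proof -
    have "1 \<le> k \<longleftrightarrow> (r + r0)\<^sup>2 \<le> R\<^sup>2"
      unfolding k_def using r by (simp add: pos_le_divide_eq power2_eq_square algebra_simps)
    also have "\<dots> \<longleftrightarrow> r \<le> R - r0"
      using r by (subst abs_le_square_iff[symmetric]) auto
    finally show ?thesis .
  qed
  have k_le: "-1 \<le> k \<longleftrightarrow> r \<le> R + r0"
  proof -
    have "-1 \<le> k \<longleftrightarrow> (r - r0)\<^sup>2 \<le> R\<^sup>2"
      unfolding k_def using r by (simp add: pos_le_divide_eq power2_eq_square algebra_simps)
    also have "\<dots> \<longleftrightarrow> r \<le> R + r0"
      using r by (subst abs_le_square_iff[symmetric]) auto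
    finally show ?thesis .
  qed
  have mk: "- k = (r\<^sup>2 + r0\<^sup>2 - R\<^sup>2) / (2 * r0 * r)"
    unfolding k_def minus_divide_left by simp
  consider "1 \<le> k" | "-1 \<le> k" "k < 1" | "k < -1" by linarith
  then show ?thesis
  proof cases
    case 1
    then have "{t \<in> {-pi..<pi}. cmod (of_real r0 + of_real r * cis t) \<le> R} = {-pi..<pi}"
      unfolding iff using cos_le_one order_trans by blast
    then show ?thesis using 1 k_ge by simp
  next
    case 2
    then show ?thesis using emeasure_cos_le[of k] k_ge k_le mk iff by simp
  next
    case 3
    then have "{t \<in> {-pi..<pi}. cmod (of_real r0 + of_real r * cis t) \<le> R} = {}"
      unfolding iff using cos_ge_minus_one by (smt (verit) Collect_empty_eq)
    then show ?thesis using 3 k_ge k_le by (simp only: emeasure_empty) auto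
  qed
qed

subsection \<open>The spatial average over the disk\<close>

text \<open>The two squares that decided the arc cases, now in the normalized distance. Continuity
  and sign of arccos are available only on this range of arguments.\<close>

lemma Z1_integrand_bounds:
  fixes x y r :: real
  assumes y: "0 < y" "y \<le> x" and r: "r \<in> {(x - y) / y .. (x + y) / y}"
  shows "-1 \<le> (y\<^sup>2 * r\<^sup>2 + y\<^sup>2 - x\<^sup>2) / (2 * y\<^sup>2 * r)"
    and "(y\<^sup>2 * r\<^sup>2 + y\<^sup>2 - x\<^sup>2) / (2 * y\<^sup>2 * r) \<le> 1"
proof -
  have "\<bar>(y\<^sup>2 * r\<^sup>2 + y\<^sup>2 - x\<^sup>2) / (2 * y\<^sup>2 * r)\<bar> \<le> 1"
  \<comment> \<open>Distance 0 belongs to the interval only if \<open>x = y\<close>; the quotient is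
    then 0 by the convention for division by zero.\<close>
  proof (cases "r = 0")
    case False
    have yr: "x - y \<le> y * r" "y * r \<le> x + y"
      using r y by (auto simp: field_simps)
    have "0 \<le> (x - y) / y" using y by simp
    with r False have r0: "0 < r" by auto
    have "(y * r - y)\<^sup>2 \<le> x\<^sup>2"
      using yr y by (subst abs_le_square_iff[symmetric]) (auto simp: abs_le_iff)
    moreover have "x\<^sup>2 \<le> (y * r + y)\<^sup>2"
      using yr y by (intro power_mono) auto
    ultimately have "\<bar>y\<^sup>2 * r\<^sup>2 + y\<^sup>2 - x\<^sup>2\<bar> \<le> 2 * y\<^sup>2 * r"
      by (simp add: abs_le_iff power2_eq_square algebra_simps)
    moreover have "0 < 2 * y\<^sup>2 * r" using y r0 by simp
    ultimately show ?thesis by (simp add: abs_divide divide_le_eq)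
  qed simp
  then show "-1 \<le> (y\<^sup>2 * r\<^sup>2 + y\<^sup>2 - x\<^sup>2) / (2 * y\<^sup>2 * r)"
    and "(y\<^sup>2 * r\<^sup>2 + y\<^sup>2 - x\<^sup>2) / (2 * y\<^sup>2 * r) \<le> 1"
    by linarith+
qed

text \<open>Continuity up to the endpoints ensures that the integral in \<open>Z1\<close> exists and
  is not a default value. The delicate case is a receiver on the boundary circle, where the interval
  starts at 0.\<close>

lemma continuous_on_Z1_integrand:
  fixes \<alpha> \<beta> x y :: real
  assumes \<alpha>: "0 < \<alpha>" and \<beta>: "0 < \<beta>" and y: "0 < y" "y \<le> x"
  shows "continuous_on {(x - y) / y .. (x + y) / y}
    (\<lambda>r. r powr (\<alpha> + 1) / (\<beta> + r powr \<alpha>) * arccos ((y\<^sup>2 * r\<^sup>2 + y\<^sup>2 - x\<^sup>2) / (2 * y\<^sup>2 * r)))"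
proof -
  let ?A = "{(x - y) / y .. (x + y) / y}"
  have pos: "0 \<le> r" if "r \<in> ?A" for r
    using that y by (metis atLeastAtMost_iff diff_ge_0_iff_ge divide_nonneg_pos order_trans)
  have "continuous_on ?A (\<lambda>r. r powr c)" if "0 < c" for c :: real
    using that pos by (intro continuous_on_powr' continuous_on_id continuous_on_const) auto
  from this[of "\<alpha> + 1"] this[of \<alpha>]
  have "continuous_on ?A (\<lambda>r. r powr (\<alpha> + 1))" "continuous_on ?A (\<lambda>r. r powr \<alpha>)"
    using \<alpha> by simp_all
  moreover have "\<beta> + r powr \<alpha> \<noteq> 0" for r
    using \<beta> by (metis add_pos_nonneg less_irrefl powr_ge_zero)
  ultimately have 1: "continuous_on ?A (\<lambda>r. r powr (\<alpha> + 1) / (\<beta> + r powr \<alpha>))"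
    by (intro continuous_on_divide continuous_on_add continuous_on_const) auto
  have "continuous_on ?A (\<lambda>r. (y\<^sup>2 * r\<^sup>2 + y\<^sup>2 - x\<^sup>2) / (2 * y\<^sup>2 * r))"
  proof (cases "x = y")
    case True
    \<comment> \<open>here \<open>r = 0\<close> is admissible and relies on \<open>0 / 0 = 0\<close>\<close>
    have "continuous_on ?A (\<lambda>r. r / 2)" by (intro continuous_intros) auto
    moreover have "(y\<^sup>2 * r\<^sup>2 + y\<^sup>2 - x\<^sup>2) / (2 * y\<^sup>2 * r) = r / 2" for r
      using y True by (simp add: power2_eq_square)
    ultimately show ?thesis by (simp only:)
  next
    case False
    have "0 < (x - y) / y" using False y by simp
    then have "2 * y\<^sup>2 * r \<noteq> 0" if "r \<in> ?A" for r
      using that y by auto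
    then show ?thesis by (intro continuous_intros) auto
  qed
  then have "continuous_on ?A (\<lambda>r. arccos ((y\<^sup>2 * r\<^sup>2 + y\<^sup>2 - x\<^sup>2) / (2 * y\<^sup>2 * r)))"
    using Z1_integrand_bounds[OF y] by (intro continuous_on_arccos) auto
  with 1 show ?thesis by (rule continuous_on_mult)
qed

lemma continuous_on_Psi_integrand:
  fixes \<alpha> \<beta> x :: real
  assumes \<alpha>: "0 < \<alpha>" and \<beta>: "0 < \<beta>"
  shows "continuous_on {0..x} (\<lambda>r. r powr (\<alpha> + 1) / (1 + r powr \<alpha> * inverse \<beta>))"
proof -
  have "continuous_on {0..x} (\<lambda>r. r powr c)" if "0 < c" for c :: real
    using that by (intro continuous_on_powr' continuous_on_id continuous_on_const) auto
  from this[of "\<alpha> + 1"] this[of \<alpha>]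
  have "continuous_on {0..x} (\<lambda>r. r powr (\<alpha> + 1))" "continuous_on {0..x} (\<lambda>r. r powr \<alpha>)"
    using \<alpha> by simp_all
  moreover have "1 + r powr \<alpha> * inverse \<beta> \<noteq> 0" for r
  proof -
    have "0 \<le> r powr \<alpha> * inverse \<beta>" using \<beta> by simp
    then show ?thesis by linarith
  qed
  ultimately show ?thesis
    by (intro continuous_on_divide continuous_on_add continuous_on_mult continuous_on_const) auto
qed

text \<open>The bridge from the gauge integrals in \<open>Psi\<close> and \<open>Z1\<close> to
  Lebesgue integrals on the whole line. Measurability is part of the conclusion because
  \<open>f\<close> is controlled on the interval only.\<close>

lemma nn_integral_indicator_continuous:
  fixes f :: "real \<Rightarrow> real"
  assumes "continuous_on {a..b} f" and nonneg: "\<And>x. x \<in> {a..b} \<Longrightarrow> 0 \<le> f x" and c: "0 \<le> c"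
  shows "(\<lambda>x. ennreal (indicator {a..b} x * (c * f x))) \<in> borel_measurable borel"
    and "(\<integral>\<^sup>+x. ennreal (indicator {a..b} x * (c * f x)) \<partial>lborel) = ennreal (c * integral {a..b} f)"
proof -
  have cont: "continuous_on {a..b} (\<lambda>x. c * f x)"
    by (intro continuous_on_mult continuous_on_const assms)
  then have "(\<lambda>x. indicator {a..b} x *\<^sub>R (c * f x)) \<in> borel_measurable borel"
    by (intro borel_measurable_continuous_on_indicator) auto
  then show "(\<lambda>x. ennreal (indicator {a..b} x * (c * f x))) \<in> borel_measurable borel"
    by simp
  show "(\<integral>\<^sup>+x. ennreal (indicator {a..b} x * (c * f x)) \<partial>lborel) = ennreal (c * integral {a..b} f)"
    using assms
    by (intro nn_integral_has_integral_lebesgue has_integral_mult_right integrable_integral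
        integrable_continuous_real) auto
qed

text \<open>The integrand is \<open>r\<^sup>\<alpha> / (\<beta> + r\<^sup>\<alpha>)\<close>, written so that it takes the value 1 rather than 0 at the
  receiver, where the interference is 0 by convention.\<close>

lemma nn_integral_disk_eq_T_avg:
  fixes \<phi> :: real
  assumes \<alpha>: "0 < \<alpha>" and \<beta>: "0 < \<beta>" and r0: "0 < r0" "r0 \<le> R"
  shows "(\<integral>\<^sup>+z. indicator (cball 0 R) z *
      ennreal (1 / (1 + \<beta> * (cmod (z - of_real r0 * cis \<phi>) / r0) powr (- \<alpha>))) \<partial>lborel) =
      ennreal (region_area R * T_avg \<alpha> \<beta> R r0)" (is "?lhs = _")
    and "0 \<le> T_avg \<alpha> \<beta> R r0"
proof -
  define a where "a = (R - r0) / r0"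
  define b where "b = (R + r0) / r0"
  define h where "h = (\<lambda>s. 1 / (1 + \<beta> * s powr (- \<alpha>)))"
  define m where "m = (\<lambda>r. emeasure lborel {t \<in> {-pi..<pi}. cmod (of_real r0 + of_real r * cis t) \<le> R})"
  define w where "w = (\<lambda>s. (r0\<^sup>2 * s\<^sup>2 + r0\<^sup>2 - R\<^sup>2) / (2 * r0\<^sup>2 * s))"
  define f1 where "f1 = (\<lambda>s. s powr (\<alpha> + 1) / (1 + s powr \<alpha> * inverse \<beta>))"
  define f2 where "f2 = (\<lambda>s. s powr (\<alpha> + 1) / (\<beta> + s powr \<alpha>) * arccos (w s))"
  have ab: "0 \<le> a" "a \<le> b" using r0 by (auto simp: a_def b_def divide_right_mono)
  have [measurable]: "h \<in> borel_measurable borel" unfolding h_def by measurable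
  have [measurable]: "m \<in> borel_measurable borel"
    unfolding m_def by measurable
  have sh: "s * h s = s powr (\<alpha> + 1) / (\<beta> + s powr \<alpha>)" if "0 < s" for s
  proof -
    have "0 < s powr \<alpha>" "s powr (\<alpha> + 1) = s * s powr \<alpha>"
      using that by (simp_all add: powr_add)
    then show ?thesis
      using \<beta> unfolding h_def powr_minus by (simp add: field_simps)
  qed
  \<comment> \<open>The integrand of \<open>Psi\<close> is scaled by \<open>\<beta>\<close> compared
    with that of \<open>Z1\<close>; this is the origin of the extra \<open>\<beta>\<close> in the
    denominator of the first term of \<open>T_avg\<close>.\<close>
  have f1_eq: "f1 s = \<beta> * (s powr (\<alpha> + 1) / (\<beta> + s powr \<alpha>))" for s
    unfolding f1_def using \<beta> by (simp add: field_simps)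
  have cont1: "continuous_on {0..a} f1"
    unfolding f1_def by (rule continuous_on_Psi_integrand[OF \<alpha> \<beta>])
  have cont2: "continuous_on {a..b} f2"
    unfolding f2_def w_def a_def b_def by (rule continuous_on_Z1_integrand[OF \<alpha> \<beta> r0])
  have nn1: "0 \<le> f1 s" for s unfolding f1_def using \<beta> by simp
  have nn2: "0 \<le> f2 s" if "s \<in> {a..b}" for s
    using Z1_integrand_bounds[OF r0, of s] that \<beta>
    unfolding f2_def w_def a_def b_def by (intro mult_nonneg_nonneg arccos_lbound) auto
  have integrals: "integral {0..a} f1 = Psi \<alpha> \<beta> a" "integral {a..b} f2 = Z1 \<alpha> \<beta> R r0"
    by (simp_all add: Psi_def Z1_def f1_def f2_def w_def a_def b_def)
  have nonneg: "0 \<le> Psi \<alpha> \<beta> a" "0 \<le> Z1 \<alpha> \<beta> R r0"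
    unfolding integrals[symmetric] using nn1 nn2 cont1 cont2
    by (auto intro!: integral_nonneg integrable_continuous_real)
  note int1 = nn_integral_indicator_continuous[OF cont1 nn1, of "2 * pi * r0\<^sup>2 / \<beta>"]
  note int2 = nn_integral_indicator_continuous[OF cont2 nn2, of "2 * r0\<^sup>2"]
  have "?lhs = (\<integral>\<^sup>+r. indicator {0<..} r * ennreal r * ennreal (h (r / r0)) * m r \<partial>lborel)"
    unfolding h_def m_def
    by (rule nn_integral_disk_radial[where h = "\<lambda>r. ennreal (1 / (1 + \<beta> * (r / r0) powr (- \<alpha>)))"]) measurable
  \<comment> \<open>Passing to the normalized distance r = r0 s produces the factor r0 squared: once
    from dr and once from the polar Jacobian.\<close>
  also have "\<dots> = ennreal r0 * (\<integral>\<^sup>+s. indicator {0<..} (0 + r0 * s) * ennreal (0 + r0 * s) *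
      ennreal (h ((0 + r0 * s) / r0)) * m (0 + r0 * s) \<partial>lborel)"
    using r0 by (subst nn_integral_real_affine[where c=r0 and t=0]) simp_all
  also have "\<dots> = (\<integral>\<^sup>+s. ennreal r0 * (indicator {0<..} (0 + r0 * s) * ennreal (0 + r0 * s) *
      ennreal (h ((0 + r0 * s) / r0)) * m (0 + r0 * s)) \<partial>lborel)"
    by (rule nn_integral_cmult[symmetric]) measurable
  \<comment> \<open>Both closed intervals contain \<open>a\<close>, so the equation is claimed off
    this point. Discarding 0 as well leaves, among the nonpositive \<open>s\<close>, only negative
    ones, where both indicators vanish.\<close>
  also have "\<dots> = (\<integral>\<^sup>+s. ennreal (indicator {0..a} s * (2 * pi * r0\<^sup>2 / \<beta> * f1 s)) +
      ennreal (indicator {a..b} s * (2 * r0\<^sup>2 * f2 s)) \<partial>lborel)"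
    using AE_lborel_singleton[of 0] AE_lborel_singleton[of a]
  proof (intro nn_integral_cong_AE, eventually_elim)
    fix s :: real assume s: "s \<noteq> 0" "s \<noteq> a"
    show "ennreal r0 * (indicator {0<..} (0 + r0 * s) * ennreal (0 + r0 * s) *
      ennreal (h ((0 + r0 * s) / r0)) * m (0 + r0 * s)) =
      ennreal (indicator {0..a} s * (2 * pi * r0\<^sup>2 / \<beta> * f1 s)) +
      ennreal (indicator {a..b} s * (2 * r0\<^sup>2 * f2 s))"
    proof (cases "0 < s")
      case False
      then show ?thesis using s r0 ab by (simp add: zero_less_mult_iff)
    next
      case True
      then have rs: "0 < r0 * s" using r0 by simp
      have lea: "r0 * s \<le> R - r0 \<longleftrightarrow> s \<le> a" and leb: "r0 * s \<le> R + r0 \<longleftrightarrow> s \<le> b"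
        using r0 by (simp_all add: a_def b_def pos_le_divide_eq mult.commute)
      have weq: "((r0 * s)\<^sup>2 + r0\<^sup>2 - R\<^sup>2) / (2 * r0 * (r0 * s)) = w s"
        by (simp add: w_def power2_eq_square mult_ac)
      have m: "m (r0 * s) = (if s \<le> a then ennreal (2 * pi) else if s \<le> b then ennreal (2 * arccos (w s)) else 0)"
        unfolding m_def emeasure_arc[OF r0(1) rs r0(2)] lea leb weq ..
      have h0: "0 \<le> h s" unfolding h_def using \<beta> by simp
      have L: "ennreal r0 * (indicator {0<..} (0 + r0 * s) * ennreal (0 + r0 * s) *
          ennreal (h ((0 + r0 * s) / r0)) * m (0 + r0 * s)) = ennreal (r0\<^sup>2 * (s * h s)) * m (r0 * s)"
        using rs r0 h0 True
        by (simp add: ennreal_mult[symmetric] mult.assoc[symmetric] power2_eq_square)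
      consider "s < a" | "a < s" "s \<le> b" | "b < s" using s by linarith
      then show ?thesis
      proof cases
        case 1
        then show ?thesis
          unfolding L m f1_eq sh[OF True] using True \<beta> by (simp add: ennreal_mult[symmetric] mult_ac)
      next
        case 2
        then have "0 \<le> arccos (w s)"
          using Z1_integrand_bounds[OF r0, of s] unfolding w_def a_def b_def
          by (intro arccos_lbound) auto
        with 2 show ?thesis
          unfolding L m f2_def sh[OF True] using True \<beta> by (simp add: ennreal_mult[symmetric] mult_ac)
      next
        case 3
        then show ?thesis unfolding L m using ab by simp
      qed
    qed
  qed
  also have "\<dots> = ennreal (2 * pi * r0\<^sup>2 / \<beta> * integral {0..a} f1) + ennreal (2 * r0\<^sup>2 * integral {a..b} f2)"
    using int1 int2 \<beta> by (simp add: nn_integral_add)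
  also have "\<dots> = ennreal (2 * pi * r0\<^sup>2 / \<beta> * Psi \<alpha> \<beta> a + 2 * r0\<^sup>2 * Z1 \<alpha> \<beta> R r0)"
  proof -
    show ?thesis using \<beta> nonneg unfolding integrals by (simp add: ennreal_plus)
  qed
  also have area: "2 * pi * r0\<^sup>2 / \<beta> * Psi \<alpha> \<beta> a + 2 * r0\<^sup>2 * Z1 \<alpha> \<beta> R r0 = region_area R * T_avg \<alpha> \<beta> R r0"
  proof -
    have "region_area R \<noteq> 0" using r0 by (simp add: region_area_def)
    then show ?thesis by (simp add: T_avg_def distrib_left a_def)
  qed
  finally show "?lhs = ennreal (region_area R * T_avg \<alpha> \<beta> R r0)" .
  \<comment> \<open>The equation in \<open>ennreal\<close> does not determine the sign, so it is
    read off from the integrals \<open>Psi\<close> and \<open>Z1\<close>.\<close>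
  have "0 \<le> region_area R * T_avg \<alpha> \<beta> R r0"
    unfolding area[symmetric] using nonneg \<beta> by simp
  moreover have "0 < region_area R" using r0 by (simp add: region_area_def)
  ultimately show "0 \<le> T_avg \<alpha> \<beta> R r0" by (simp add: zero_le_mult_iff)
qed

subsection \<open>Euler's integral for the hypergeometric function\<close>

text \<open>The quotient telescopes because the parameters differ by 1; a positive real part keeps
  all factors away from 0. It reduces the Gauss coefficients to the moments of a power of t.\<close>

lemma pochhammer_ratio_Suc:
  fixes b :: complex
  assumes "0 < Re b"
  shows "pochhammer b n / pochhammer (b + 1) n = b / (b + of_nat n)"
proof -
  have "b + of_nat k \<noteq> 0" for k
  proof -
    have "0 < Re (b + of_nat k)" using assms by simp
    then show ?thesis by force
  qed
  then have nz: "b + of_nat k \<noteq> 0" "1 + (b + of_nat k) \<noteq> 0" for k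
    by (auto simp del: of_nat_Suc) (metis add.assoc add.commute of_nat_Suc)
  show ?thesis
  proof (induction n)
    case 0
    then show ?case using nz(1)[of 0] by simp
  next
    case (Suc n)
    have "pochhammer b (Suc n) / pochhammer (b + 1) (Suc n) =
      pochhammer b n / pochhammer (b + 1) n * ((b + of_nat n) / (b + 1 + of_nat n))"
      by (simp add: pochhammer_Suc)
    also have "\<dots> = b / (b + of_nat (Suc n))"
      unfolding Suc using nz(1)[of n] by (simp add: add_ac)
    finally show ?case .
  qed
qed

text \<open>A zero would force z = 1 / t, a point of the ray from 1. The cut of
  \<open>hyp2F1\<close> is thus where the kernel of Euler's integral can become singular.\<close>

lemma one_minus_mult_unit_interval_nz:
  fixes z :: complex
  assumes "z \<notin> complex_of_real ` {1..}" "t \<in> {0..1}"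
  shows "1 - z * of_real t \<noteq> 0"
proof
  assume e: "1 - z * of_real t = 0"
  then have "t \<noteq> 0" by auto
  with e have "z = of_real (1 / t)" by (simp add: field_simps)
  moreover have "1 / t \<in> {1..}" using assms(2) \<open>t \<noteq> 0\<close> by auto
  ultimately show False using assms(1) by blast
qed

lemma closed_real_ray: "closed (complex_of_real ` {1..})"
  by (rule closed_injective_linear_image) (simp_all add: inj_on_def linear_iff scaleR_conv_of_real)

text \<open>Euler's integral for the parameters 1, \<open>b\<close>, \<open>b + 1\<close>: the
  factor (1 - t)^(c - b - 1) is 1, and Gamma(c) / (Gamma(b) Gamma(c - b)) equals
  \<open>b\<close>.\<close>

definition euler_integral :: "real \<Rightarrow> complex \<Rightarrow> complex" where
  "euler_integral b z =
    of_real b * integral {0..1} (\<lambda>t. of_real (t powr (b - 1)) / (1 - z * of_real t))"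

lemma continuous_on_euler_integrand:
  assumes "z \<notin> complex_of_real ` {1..}" "1 < b"
  shows "continuous_on {0..1} (\<lambda>t::real. of_real (t powr (b - 1)) / (1 - z * of_real t))"
proof -
  have "continuous_on {0..1} (\<lambda>t::real. t powr (b - 1))"
    using assms(2) by (intro continuous_on_powr' continuous_intros) auto
  then show ?thesis
    using one_minus_mult_unit_interval_nz[OF assms(1)]
    by (intro continuous_on_divide continuous_on_of_real continuous_on_diff continuous_on_mult
        continuous_on_const continuous_on_id) auto
qed

text \<open>Differentiation under the integral sign. The rule for it asks for a convex domain, which
  the slit plane is not, so it is applied on balls, and the local results are collected as
  analyticity.\<close>

lemma holomorphic_on_euler_integral:
  assumes "1 < b"
  shows "euler_integral b holomorphic_on - (complex_of_real ` {1..})"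
  unfolding euler_integral_def
proof (intro holomorphic_on_mult holomorphic_on_const)
  let ?S = "- (complex_of_real ` {1..})"
  let ?f = "\<lambda>z t. of_real (t powr (b - 1)) / (1 - z * of_real t)"
  let ?f' = "\<lambda>z t. of_real (t powr (b - 1)) * of_real t / (1 - z * of_real t)\<^sup>2"
  have op: "open ?S" using closed_real_ray by (simp add: open_Compl)
  have on_ball: "(\<lambda>z. integral {0..1} (?f z)) holomorphic_on ball c e" if "ball c e \<subseteq> ?S" for c e
  proof -
    have nz: "1 - z * of_real t \<noteq> 0" if "z \<in> ball c e" "t \<in> {0..1}" for z t
      using one_minus_mult_unit_interval_nz that \<open>ball c e \<subseteq> ?S\<close> by blast
    have "(\<lambda>z. integral (cbox 0 1) (?f z)) holomorphic_on ball c e"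
    proof (rule leibniz_rule_holomorphic[where fx = ?f'])
      fix z and t :: real assume zt: "z \<in> ball c e" "t \<in> cbox 0 1"
      then show "((\<lambda>z. ?f z t) has_field_derivative ?f' z t) (at z within ball c e)"
        using nz[of z t] by (auto intro!: derivative_eq_intros simp: power2_eq_square)
    next
      fix z assume "z \<in> ball c e"
      then show "?f z integrable_on cbox 0 1"
        using continuous_on_euler_integrand[of z b] that assms
        by (intro integrable_continuous) (simp add: subset_iff)
    next
      have "continuous_on (ball c e \<times> cbox 0 1) (\<lambda>w. snd w powr (b - 1))"
        using assms by (intro continuous_on_powr' continuous_intros) auto
      then show "continuous_on (ball c e \<times> cbox 0 1) (\<lambda>(z, t). ?f' z t)"
        unfolding case_prod_unfold using nz
        by (intro continuous_on_divide continuous_on_of_real continuous_on_diff continuous_on_mult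
            continuous_on_power continuous_on_const continuous_on_fst continuous_on_snd
            continuous_on_id) auto
    qed simp
    then show ?thesis by simp
  qed
  have "(\<lambda>z. integral {0..1} (?f z)) analytic_on ?S"
    unfolding analytic_on_def
  proof
    fix c assume "c \<in> ?S"
    with op obtain e where "0 < e" "ball c e \<subseteq> ?S"
      by (meson open_contains_ball)
    with on_ball show "\<exists>e>0. (\<lambda>z. integral {0..1} (?f z)) holomorphic_on ball c e"
      by blast
  qed
  then show "(\<lambda>z. integral {0..1} (?f z)) holomorphic_on ?S"
    by (rule analytic_imp_holomorphic)
qed

lemma tendsto_integral_uniform_limit:
  fixes f :: "nat \<Rightarrow> real \<Rightarrow> 'b::banach"
  assumes "uniform_limit {a..b} f h sequentially" and "\<And>n. continuous_on {a..b} (f n)"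
  shows "(\<lambda>n. integral {a..b} (f n)) \<longlonglongrightarrow> integral {a..b} h"
proof -
  obtain I J where I: "\<And>n. (f n has_integral I n) {a..b}" and J: "(h has_integral J) {a..b}"
    and lim: "I \<longlonglongrightarrow> J"
    using uniform_limit_integral[OF assms trivial_limit_sequentially] by blast
  have "(\<lambda>n. integral {a..b} (f n)) = I"
    by (intro ext integral_unique I)
  with lim integral_unique[OF J] show ?thesis by simp
qed

text \<open>Expand the kernel as a geometric series and integrate termwise, the n-th moment being 1
  / (b + n). The bound by the n-th power of \<open>norm z\<close> makes the convergence uniform in
  t.\<close>

lemma euler_integral_sums:
  assumes b: "1 < b" and z: "norm z < 1"
  shows "(\<lambda>n. of_real b / (of_real b + of_nat n) * z ^ n) sums euler_integral b z"
proof -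
  have int: "((\<lambda>t. of_real (t powr (b - 1)) * (z * of_real t) ^ n) has_integral
      z ^ n / (of_real b + of_nat n)) {0..1}" for n
  proof -
    have "((\<lambda>t. t powr (b - 1 + n)) has_integral (1 / (b + n))) {0..1::real}"
      using has_integral_powr_from_0[of "b - 1 + n" 1] b by (simp add: add_ac)
    then have "((\<lambda>t. z ^ n * of_real (t powr (b - 1 + n))) has_integral (z ^ n * of_real (1 / (b + n)))) {0..1::real}"
      by (intro has_integral_mult_right has_integral_of_real)
    \<comment> \<open>At \<open>t = 0\<close> both sides are 0 because \<open>0 powr _\<close> is 0,
      even for \<open>n = 0\<close>, where the power on the right is 1.\<close>
    moreover have "z ^ n * of_real (t powr (b - 1 + n)) = of_real (t powr (b - 1)) * (z * of_real t) ^ n"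
      if "t \<in> {0..1}" for t :: real
      using that b by (cases "t = 0") (auto simp: powr_add powr_realpow power_mult_distrib)
    ultimately have "((\<lambda>t. of_real (t powr (b - 1)) * (z * of_real t) ^ n) has_integral (z ^ n * of_real (1 / (b + n)))) {0..1::real}"
      by (rule has_integral_eq[rotated])
    then show ?thesis by simp
  qed
  have lim: "uniform_limit {0..1} (\<lambda>N t. \<Sum>n<N. of_real (t powr (b - 1)) * (z * of_real t) ^ n)
     (\<lambda>t. of_real (t powr (b - 1)) / (1 - z * of_real t)) sequentially"
  proof (rule uniform_limit_cong'[THEN iffD1])
    show "uniform_limit {0..1} (\<lambda>N t. \<Sum>n<N. of_real (t powr (b - 1)) * (z * of_real t) ^ n)
      (\<lambda>t. \<Sum>n. of_real (t powr (b - 1)) * (z * of_real t) ^ n) sequentially"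
    proof (rule Weierstrass_m_test)
      fix n and t :: real assume t: "t \<in> {0..1}"
      have "norm (complex_of_real (t powr (b - 1)) * (z * of_real t) ^ n) = t powr (b - 1) * (t ^ n * norm z ^ n)"
        using t by (simp add: norm_mult norm_power power_mult_distrib)
      also have "\<dots> \<le> 1 * (1 * norm z ^ n)"
        using t b by (intro mult_mono powr_le1 power_le_one) auto
      finally show "norm (complex_of_real (t powr (b - 1)) * (z * of_real t) ^ n) \<le> norm z ^ n" by simp
    qed (use z in \<open>simp add: summable_geometric\<close>)
    fix t :: real assume t: "t \<in> {0..1}"
    then have "norm (z * of_real t) < 1"
      using z by (simp add: norm_mult) (metis abs_of_nonneg le_less_trans mult_left_le norm_ge_zero)
    then have "(\<lambda>n. (z * of_real t) ^ n) sums (1 / (1 - z * of_real t))"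
      by (rule geometric_sums)
    from sums_mult[OF this, of "of_real (t powr (b - 1))"]
    show "(\<Sum>n. of_real (t powr (b - 1)) * (z * of_real t) ^ n) = of_real (t powr (b - 1)) / (1 - z * of_real t)"
      by (simp add: sums_iff)
  qed simp
  have cont: "continuous_on {0..1} (\<lambda>t. \<Sum>n<N. of_real (t powr (b - 1)) * (z * of_real t) ^ n)" for N
  proof -
    have "continuous_on {0..1} (\<lambda>t::real. t powr (b - 1))"
      using b by (intro continuous_on_powr' continuous_on_diff continuous_on_id continuous_on_const) auto
    then show ?thesis
      by (intro continuous_on_sum continuous_on_mult continuous_on_power continuous_on_of_real
          continuous_on_const continuous_on_id)
  qed
  have "(\<lambda>N. integral {0..1} (\<lambda>t. \<Sum>n<N. of_real (t powr (b - 1)) * (z * of_real t) ^ n))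
      \<longlonglongrightarrow> integral {0..1} (\<lambda>t. of_real (t powr (b - 1)) / (1 - z * of_real t))"
    using lim cont by (rule tendsto_integral_uniform_limit)
  moreover have "integral {0..1} (\<lambda>t. \<Sum>n<N. of_real (t powr (b - 1)) * (z * of_real t) ^ n) =
    (\<Sum>n<N. z ^ n / (of_real b + of_nat n))" for N
    by (intro integral_unique has_integral_sum int) auto
  ultimately have "(\<lambda>n. z ^ n / (of_real b + of_nat n)) sums
     integral {0..1} (\<lambda>t. of_real (t powr (b - 1)) / (1 - z * of_real t))"
    by (simp add: sums_def)
  from sums_mult[OF this, of "of_real b"] show ?thesis
    by (simp add: euler_integral_def mult_ac)
qed

text \<open>Holomorphy on the slit plane and the Gauss series on the unit disk characterize the
  function. \<open>pochhammer 1 n\<close> cancels \<open>fact n\<close>, and what remains is the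
  telescoping quotient.\<close>

lemma hyp2F1_euler:
  assumes "1 < b" "z \<notin> complex_of_real ` {1..}"
  shows "hyp2F1 1 (of_real b) (of_real (b + 1)) z = euler_integral b z"
proof (rule hyp2F1_eqI[OF holomorphic_on_euler_integral[OF assms(1)] _ assms(2)])
  fix u :: complex assume "norm u < 1"
  have "pochhammer 1 n * pochhammer (of_real b) n / pochhammer (of_real (b + 1)) n * u ^ n / fact n
     = of_real b / (of_real b + of_nat n) * u ^ n" for n
    using pochhammer_ratio_Suc[of "of_real b" n] assms(1)
    by (simp add: pochhammer_fact[symmetric]) (metis mult.commute times_divide_eq_left)
  then show "(\<lambda>n. pochhammer 1 n * pochhammer (of_real b) n / pochhammer (of_real (b + 1)) n * u ^ n / fact n)
    sums euler_integral b u"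
    using euler_integral_sums[OF assms(1) \<open>norm u < 1\<close>] by simp
qed

lemma Psi_eq_hyp2F1:
  assumes \<alpha>: "0 < \<alpha>" and \<beta>: "0 < \<beta>" and x: "0 \<le> x"
  shows "complex_of_real (Psi \<alpha> \<beta> x)
              = of_real (x powr (\<alpha> + 2) / (2 + \<alpha>))
                * hyp2F1 1 (of_real (2 / \<alpha> + 1)) (of_real (2 / \<alpha> + 2))
                    (of_real (- (x powr \<alpha>) / \<beta>))"
proof (cases "x = 0")
  case True
  then show ?thesis by (simp add: Psi_def)
next
  case False
  with x have x: "0 < x" by simp
  define y where "y = x powr \<alpha> / \<beta>"
  have y: "0 < y" using x \<beta> by (simp add: y_def)
  define f where "f = (\<lambda>t. t powr (2 / \<alpha>) / (1 + y * t))"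
  define h where "h = (\<lambda>r. (r / x) powr \<alpha>)"
  have f: "continuous_on {0..1} f"
  proof -
    have "continuous_on {0..1} (\<lambda>t::real. t powr (2 / \<alpha>))"
      using \<alpha> by (intro continuous_on_powr' continuous_intros) auto
    moreover have "1 + y * t \<noteq> 0" if "t \<in> {0..1}" for t
      using that y mult_nonneg_nonneg[of y t] by fastforce
    ultimately show ?thesis
      unfolding f_def
      by (intro continuous_on_divide continuous_on_add continuous_on_mult continuous_on_const
          continuous_on_id) auto
  qed
  \<comment> \<open>The point 0 is exempted from the derivative condition, since \<open>h\<close> is
    not differentiable there when \<open>\<alpha> < 1\<close>.\<close>
  have "((\<lambda>r. (\<alpha> / x * (r / x) powr (\<alpha> - 1)) *\<^sub>R f (h r)) has_integral
      (integral {h 0..h x} f - integral {h x..h 0} f)) {0..x}"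
  proof (rule has_integral_substitution_general[where s="{0}" and c=0 and d=1])
    show "h ` {0..x} \<subseteq> {0..1}"
      using x \<alpha> by (auto simp: h_def intro!: powr_le1)
    show "continuous_on {0..x} h"
      unfolding h_def using x \<alpha> by (intro continuous_on_powr' continuous_intros) auto
    show "(h has_real_derivative \<alpha> / x * (r / x) powr (\<alpha> - 1)) (at r within {0..x})" if "r \<in> {0..x} - {0}" for r
    proof -
      have "((\<lambda>r. r / x) has_real_derivative 1 / x) (at r within {0..x})"
        using x by (auto intro!: derivative_eq_intros)
      from DERIV_chain2[OF has_real_derivative_powr[of "r / x" \<alpha>] this]
      show ?thesis unfolding h_def using that x by (simp add: mult_ac)
    qed
  qed (use x f in auto)
  then have 1: "((\<lambda>r. (\<alpha> / x * (r / x) powr (\<alpha> - 1)) * f (h r)) has_integral integral {0..1} f) {0..x}"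
    using x \<alpha> by (simp add: h_def)
  have eq: "x powr (\<alpha> + 2) / \<alpha> * ((\<alpha> / x * (r / x) powr (\<alpha> - 1)) * f (h r)) =
     r powr (\<alpha> + 1) / (1 + r powr \<alpha> * inverse \<beta>)" if "r \<in> {0..x}" for r
  proof -
    have 2: "(h r) powr (2 / \<alpha>) = (r / x) powr 2" using \<alpha> by (simp add: h_def powr_powr)
    have 3: "y * h r = r powr \<alpha> * inverse \<beta>"
      using that x by (simp add: y_def h_def powr_divide field_simps)
    have 4: "x powr (\<alpha> + 2) / \<alpha> * ((\<alpha> / x * (r / x) powr (\<alpha> - 1)) * (r / x) powr 2) = r powr (\<alpha> + 1)"
    proof (cases "r = 0")
      case True
      then show ?thesis by (simp only: div_0 powr_0 mult_zero_right)
    next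
      case False
      with that have r: "0 < r" by simp
      have "\<alpha> - 1 + 2 = \<alpha> + 1" by simp
      then have 5: "(r / x) powr (\<alpha> - 1) * (r / x) powr 2 = r powr (\<alpha> + 1) / x powr (\<alpha> + 1)"
        using powr_add[of "r / x" "\<alpha> - 1" 2] powr_divide[of r x "\<alpha> + 1"] r x
        by (simp add: add.commute)
      have 6: "x powr (\<alpha> + 2) = x * x powr (\<alpha> + 1)"
        using powr_mult_base[of x "1 + \<alpha>"] x by (simp add: add_ac)
      have cancel: "x * u / \<alpha> * ((\<alpha> / x * p) * q) = v" if "u \<noteq> 0" "p * q = v / u" for u v p q
      proof -
        have "x * u / \<alpha> * ((\<alpha> / x * p) * q) = u * (p * q)" using x \<alpha> by simp
        then show ?thesis using that by simp
      qed
      show ?thesis unfolding 6 by (rule cancel[OF _ 5]) (use x in simp)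
    qed
    have "x powr (\<alpha> + 2) / \<alpha> * ((\<alpha> / x * (r / x) powr (\<alpha> - 1)) * f (h r)) =
      x powr (\<alpha> + 2) / \<alpha> * ((\<alpha> / x * (r / x) powr (\<alpha> - 1)) * (h r) powr (2 / \<alpha>)) / (1 + y * h r)"
      unfolding f_def by (simp only: times_divide_eq_right)
    then show ?thesis by (simp only: 2 3 4)
  qed
  have Psi: "Psi \<alpha> \<beta> x = x powr (\<alpha> + 2) / \<alpha> * integral {0..1} f"
    unfolding Psi_def
    using has_integral_eq[OF eq has_integral_mult_right[OF 1, of "x powr (\<alpha> + 2) / \<alpha>"]]
    by (rule integral_unique)
  define b where "b = 2 / \<alpha> + 1"
  \<comment> \<open>The argument is negative, hence off the cut however large \<open>x\<close> is,
    also beyond the disk of convergence.\<close>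
  have "of_real (- y) \<notin> complex_of_real ` {1..}" using y by (auto simp del: of_real_minus)
  then have "hyp2F1 1 (of_real b) (of_real (b + 1)) (of_real (- y)) = euler_integral b (of_real (- y))"
    using \<alpha> by (intro hyp2F1_euler) (auto simp: b_def)
  also have "\<dots> = of_real b * integral {0..1} (\<lambda>t. of_real (f t))"
    by (simp add: euler_integral_def f_def b_def)
  also have "\<dots> = of_real (b * integral {0..1} f)"
  proof -
    have "((\<lambda>t. complex_of_real (f t)) has_integral of_real (integral {0..1} f)) {0..1}"
      by (intro has_integral_of_real integrable_integral integrable_continuous_real f)
    then show ?thesis by (simp add: integral_unique)
  qed
  finally have "hyp2F1 1 (of_real b) (of_real (b + 1)) (of_real (- y)) = of_real (b * integral {0..1} f)" .
  moreover have "2 / \<alpha> + 2 = b + 1" "- (x powr \<alpha>) / \<beta> = - y" by (simp_all add: b_def y_def)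
  \<comment> \<open>The constant \<open>b\<close> of Euler's integral converts the 1 / \<alpha> left
    by the substitution into 1 / (2 + \<alpha>).\<close>
  moreover have "Psi \<alpha> \<beta> x = x powr (\<alpha> + 2) / (2 + \<alpha>) * (b * integral {0..1} f)"
  proof -
    have "b = (2 + \<alpha>) / \<alpha>" unfolding b_def using \<alpha> by (simp add: field_simps)
    moreover have "A / (2 + \<alpha>) * ((2 + \<alpha>) / \<alpha> * J) = A / \<alpha> * J" for A J :: real
      using \<alpha> by simp
    ultimately show ?thesis unfolding Psi by (simp only:)
  qed
  ultimately show ?thesis
    unfolding b_def[symmetric] by (simp only: of_real_mult)
qed

subsection \<open>Independence and exponential fading\<close>

text \<open>Generating sigma-algebras from disjoint blocks of independent intersection-stable
  families preserves independence, and each variable reads only its own block. The families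
  \<open>E s\<close> need not come from variables of a common type.\<close>

lemma (in prob_space) indep_vars_from_indep_sets:
  assumes indep: "indep_sets E S"
    and sub: "\<And>k. k \<in> J \<Longrightarrow> K k \<subseteq> S"
    and disj: "disjoint_family_on K J"
    and stable: "\<And>s. s \<in> S \<Longrightarrow> Int_stable (E s)"
    and f: "\<And>k. k \<in> J \<Longrightarrow> f k \<in> measurable (sigma (space M) (\<Union>s\<in>K k. E s)) (N k)"
  shows "indep_vars N f J"
proof -
  have ev: "E s \<subseteq> events" if "s \<in> S" for s
    using indep that by (auto simp: indep_sets_def)
  have evK: "(\<Union>s\<in>K k. E s) \<subseteq> events" if "k \<in> J" for k
    using sub[OF that] ev by blast
  have ind: "indep_sets (\<lambda>k. sigma_sets (space M) (\<Union>s\<in>K k. E s)) J"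
  proof (rule indep_sets_collect_sigma)
    show "indep_sets E (\<Union>k\<in>J. K k)"
      by (rule indep_sets_mono_index[OF _ indep]) (use sub in blast)
  qed (use stable sub disj in blast)+
  have sets_sigma: "sets (sigma (space M) (\<Union>s\<in>K k. E s)) = sigma_sets (space M) (\<Union>s\<in>K k. E s)"
    if "k \<in> J" for k
    using evK[OF that] sets.sets_into_space by (intro sets_measure_of) blast
  have pre: "f k -` A \<inter> space M \<in> sigma_sets (space M) (\<Union>s\<in>K k. E s)"
    if "k \<in> J" "A \<in> sets (N k)" for k A
    using measurable_sets[OF f[OF that(1)] that(2)] sets_sigma[OF that(1)]
    by (simp add: space_measure_of_conv)
  have rv: "random_variable (N k) (f k)" if k: "k \<in> J" for k
  proof (rule measurableI)
    show "f k x \<in> space (N k)" if "x \<in> space M" for x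
      using measurable_space[OF f[OF k], of x] that by (simp add: space_measure_of_conv)
    show "f k -` A \<inter> space M \<in> events" if "A \<in> sets (N k)" for A
      using pre[OF k that] sets.sigma_sets_subset[OF evK[OF k]] by blast
  qed
  show ?thesis
    unfolding indep_vars_def2
  proof (intro conjI ballI rv)
    show "indep_sets (\<lambda>k. {f k -` A \<inter> space M |A. A \<in> sets (N k)}) J"
      by (rule indep_sets_mono_sets[OF ind]) (use pre in blast)
  qed
qed

text \<open>The joint law is a product measure, so Tonelli allows \<open>B\<close> to be frozen
  while \<open>A\<close> is averaged. Both integrals are pulled back to the original space, which
  makes repeated conditioning convenient.\<close>

lemma (in prob_space) nn_integral_indep_var:
  assumes indep: "indep_var S A T B"
    and h [measurable]: "h \<in> borel_measurable (S \<Otimes>\<^sub>M T)"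
  shows "(\<integral>\<^sup>+\<omega>. h (A \<omega>, B \<omega>) \<partial>M) = (\<integral>\<^sup>+\<omega>. (\<integral>\<^sup>+\<omega>'. h (A \<omega>', B \<omega>) \<partial>M) \<partial>M)"
proof -
  note [measurable] = indep_var_rv1[OF indep] indep_var_rv2[OF indep]
  interpret A: prob_space "distr M S A" by (rule prob_space_distr) measurable
  interpret B: prob_space "distr M T B" by (rule prob_space_distr) measurable
  interpret AB: pair_sigma_finite "distr M S A" "distr M T B" ..
  have h': "h \<in> borel_measurable (distr M S A \<Otimes>\<^sub>M distr M T B)" by simp
  have "(\<integral>\<^sup>+\<omega>. h (A \<omega>, B \<omega>) \<partial>M) = (\<integral>\<^sup>+w. h w \<partial>distr M (S \<Otimes>\<^sub>M T) (\<lambda>\<omega>. (A \<omega>, B \<omega>)))"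
    by (simp add: nn_integral_distr)
  also have "\<dots> = (\<integral>\<^sup>+w. h w \<partial>(distr M S A \<Otimes>\<^sub>M distr M T B))"
    using indep by (simp add: indep_var_distribution_eq)
  also have "\<dots> = (\<integral>\<^sup>+b. (\<integral>\<^sup>+a. h (a, b) \<partial>distr M S A) \<partial>distr M T B)"
    by (rule AB.nn_integral_snd[OF h', symmetric])
  also have "\<dots> = (\<integral>\<^sup>+\<omega>. (\<integral>\<^sup>+a. h (a, B \<omega>) \<partial>distr M S A) \<partial>M)"
    by (subst nn_integral_distr) simp_all
  also have "\<dots> = (\<integral>\<^sup>+\<omega>. (\<integral>\<^sup>+\<omega>'. h (A \<omega>', B \<omega>) \<partial>M) \<partial>M)"
    by (intro nn_integral_cong nn_integral_distr)
      (auto intro!: measurable_compose[OF _ h] measurable_Pair measurable_const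
        dest: measurable_space[OF indep_var_rv2[OF indep]])
  finally show ?thesis .
qed

text \<open>Freeze \<open>B\<close> and use the exponential tail, which has the form exp(-b) only
  for nonnegative b. Nonnegativity is asked almost everywhere because the interference has it only
  in that sense.\<close>

lemma (in prob_space) emeasure_exponential_gt_indep:
  assumes indep: "indep_var borel A borel B"
    and A: "distributed M lborel A (exponential_density 1)"
    and B: "AE \<omega> in M. 0 \<le> B \<omega>"
  shows "emeasure M {\<omega> \<in> space M. B \<omega> < A \<omega>} = (\<integral>\<^sup>+\<omega>. ennreal (exp (- B \<omega>)) \<partial>M)"
proof -
  note [measurable] = indep_var_rv1[OF indep] indep_var_rv2[OF indep]
  have "emeasure M {\<omega> \<in> space M. B \<omega> < A \<omega>} =
      (\<integral>\<^sup>+\<omega>. indicator {w. snd w < fst w} (A \<omega>, B \<omega>) \<partial>M)"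
  proof -
    have "emeasure M {\<omega> \<in> space M. B \<omega> < A \<omega>} =
        (\<integral>\<^sup>+\<omega>. indicator {\<omega> \<in> space M. B \<omega> < A \<omega>} \<omega> \<partial>M)"
      by (rule nn_integral_indicator[symmetric]) measurable
    also have "\<dots> = (\<integral>\<^sup>+\<omega>. indicator {w. snd w < fst w} (A \<omega>, B \<omega>) \<partial>M)"
      by (intro nn_integral_cong) (auto simp: indicator_def)
    finally show ?thesis .
  qed
  also have "\<dots> = (\<integral>\<^sup>+\<omega>. (\<integral>\<^sup>+\<omega>'. indicator {w. snd w < fst w} (A \<omega>', B \<omega>) \<partial>M) \<partial>M)"
    by (rule nn_integral_indep_var[OF indep]) measurable
  also have "\<dots> = (\<integral>\<^sup>+\<omega>. ennreal (exp (- B \<omega>)) \<partial>M)"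
    using B
  proof (intro nn_integral_cong_AE, eventually_elim)
    fix \<omega> assume "0 \<le> B \<omega>"
    then have "prob {\<omega>' \<in> space M. B \<omega> < A \<omega>'} = exp (- B \<omega>)"
      using exponential_distributedD_gt[OF A] by simp
    moreover have "(\<integral>\<^sup>+\<omega>'. indicator {w. snd w < fst w} (A \<omega>', B \<omega>) \<partial>M) =
        emeasure M {\<omega>' \<in> space M. B \<omega> < A \<omega>'}"
    proof -
      have "emeasure M {\<omega>' \<in> space M. B \<omega> < A \<omega>'} =
          (\<integral>\<^sup>+\<omega>'. indicator {\<omega>' \<in> space M. B \<omega> < A \<omega>'} \<omega>' \<partial>M)"
        by (rule nn_integral_indicator[symmetric]) measurable
      also have "\<dots> = (\<integral>\<^sup>+\<omega>'. indicator {w. snd w < fst w} (A \<omega>', B \<omega>) \<partial>M)"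
        by (intro nn_integral_cong) (auto simp: indicator_def)
      finally show ?thesis ..
    qed
    ultimately show "(\<integral>\<^sup>+\<omega>'. indicator {w. snd w < fst w} (A \<omega>', B \<omega>) \<partial>M) = ennreal (exp (- B \<omega>))"
      by (simp add: emeasure_eq_measure)
  qed
  finally show ?thesis .
qed

text \<open>Exponential tilting: the integrand is 1 / (1 + c) times the exponential density of rate
  1 + c, which has total mass 1.\<close>

lemma nn_integral_exponential_laplace:
  assumes A: "distributed M lborel A (exponential_density 1)" and c: "0 \<le> c"
  shows "(\<integral>\<^sup>+\<omega>. ennreal (exp (- (c * A \<omega>))) \<partial>M) = ennreal (1 / (1 + c))"
proof -
  interpret E: prob_space "density lborel (exponential_density (1 + c))"
    using c by (intro prob_space_exponential_density) simp
  have "(\<integral>\<^sup>+\<omega>. ennreal (exp (- (c * A \<omega>))) \<partial>M) =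
      (\<integral>\<^sup>+x. ennreal (exponential_density 1 x) * ennreal (exp (- (c * x))) \<partial>lborel)"
    by (rule distributed_nn_integral[OF A, symmetric]) measurable
  also have "\<dots> = (\<integral>\<^sup>+x. ennreal (1 / (1 + c)) * ennreal (exponential_density (1 + c) x) \<partial>lborel)"
  proof (rule nn_integral_cong)
    fix x :: real
    have "exponential_density 1 x * exp (- (c * x)) = 1 / (1 + c) * exponential_density (1 + c) x"
      using c by (simp add: exponential_density_def exp_add[symmetric]) (simp add: algebra_simps)
    then show "ennreal (exponential_density 1 x) * ennreal (exp (- (c * x))) =
        ennreal (1 / (1 + c)) * ennreal (exponential_density (1 + c) x)"
      using c by (simp add: ennreal_mult[symmetric] exponential_density_nonneg)
  qed
  also have "\<dots> = ennreal (1 / (1 + c)) * (\<integral>\<^sup>+x. ennreal (exponential_density (1 + c) x) \<partial>lborel)"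
    by (rule nn_integral_cmult) measurable
  also have "(\<integral>\<^sup>+x. ennreal (exponential_density (1 + c) x) \<partial>lborel) = 1"
    using E.emeasure_space_1 by (simp add: emeasure_density)
  finally show ?thesis by simp
qed

lemma measurable_sigma_source:
  assumes h: "h \<in> space P \<rightarrow> space N"
    and sub: "sets (vimage_algebra (space P) h N) \<subseteq> G" and G: "G \<subseteq> Pow (space P)"
  shows "h \<in> measurable (sigma (space P) G) N"
proof (rule measurableI)
  fix A assume "A \<in> sets N"
  then have "h -` A \<inter> space P \<in> G"
    using sub by (auto intro: in_vimage_algebra)
  then show "h -` A \<inter> space (sigma (space P) G) \<in> sets (sigma (space P) G)"
    using G by (auto simp: space_measure_of_conv)
qed (use h in \<open>auto simp: space_measure_of_conv\<close>)

lemma measurable_sigma_sources: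
  assumes "s \<in> K"
  shows "s = Fading i j \<Longrightarrow> g i j \<in> measurable (sigma (space P) (\<Union>s\<in>K. source_events P g I X s)) borel"
    and "s = Access i \<Longrightarrow> I i \<in> measurable (sigma (space P) (\<Union>s\<in>K. source_events P g I X s)) (count_space UNIV)"
    and "s = Position i \<Longrightarrow> X i \<in> measurable (sigma (space P) (\<Union>s\<in>K. source_events P g I X s)) borel"
proof -
  have "source_events P g I X t \<subseteq> Pow (space P)" for t
    using sets.sets_into_space by (cases t) fastforce+
  then have G: "(\<Union>s\<in>K. source_events P g I X s) \<subseteq> Pow (space P)" by blast
  show "s = Fading i j \<Longrightarrow> g i j \<in> measurable (sigma (space P) (\<Union>s\<in>K. source_events P g I X s)) borel"
    by (rule measurable_sigma_source[OF _ _ G]) (use assms in \<open>force+\<close>)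
  show "s = Access i \<Longrightarrow> I i \<in> measurable (sigma (space P) (\<Union>s\<in>K. source_events P g I X s)) (count_space UNIV)"
    by (rule measurable_sigma_source[OF _ _ G]) (use assms in \<open>force+\<close>)
  show "s = Position i \<Longrightarrow> X i \<in> measurable (sigma (space P) (\<Union>s\<in>K. source_events P g I X s)) borel"
    by (rule measurable_sigma_source[OF _ _ G]) (use assms in \<open>force+\<close>)
qed

lemma Int_stable_source_events: "Int_stable (source_events P g I X s)"
  by (cases s) (auto simp: Int_stable_def)

subsection \<open>The outage probability\<close>

lemma (in prob_space) indep_var_from_indep_sets:
  assumes indep: "indep_sets E S"
    and sub: "K1 \<subseteq> S" "K2 \<subseteq> S" and disj: "K1 \<inter> K2 = {}"
    and stable: "\<And>s. s \<in> S \<Longrightarrow> Int_stable (E s)"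
    and A: "A \<in> measurable (sigma (space M) (\<Union>s\<in>K1. E s)) N1"
    and B: "B \<in> measurable (sigma (space M) (\<Union>s\<in>K2. E s)) N2"
  shows "indep_var N1 A N2 B"
  unfolding indep_var_def
  by (rule indep_vars_from_indep_sets[OF indep, where K = "case_bool K1 K2"])
    (use sub disj stable A B in \<open>auto simp: disjoint_family_on_def split: bool.splits\<close>)

locale rayleigh_network = prob_space P
  for P :: "'w measure"
    and g :: "nat \<Rightarrow> nat \<Rightarrow> 'w \<Rightarrow> real"
    and I :: "nat \<Rightarrow> 'w \<Rightarrow> bool"
    and X :: "nat \<Rightarrow> 'w \<Rightarrow> complex"
    and M :: nat
    and \<alpha> \<beta> SNR r0 r_out \<theta> p :: real +
  assumes \<alpha>: "0 < \<alpha>" and \<beta>: "0 < \<beta>" and SNR: "0 < SNR"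
    and r0: "0 < r0" "r0 \<le> r_out"
    and p: "0 \<le> p" "p \<le> 1"
    and fading: "\<And>i j. i \<le> M \<Longrightarrow> j \<in> {1, 2} \<Longrightarrow>
          distributed P lborel (g i j) (exponential_density 1)"
    and access_measurable: "\<And>i. i \<in> {1..M} \<Longrightarrow> I i \<in> measurable P (count_space UNIV)"
    and access: "\<And>i. i \<in> {1..M} \<Longrightarrow>
          distr P (count_space UNIV) (I i) = measure_pmf (bernoulli_pmf p)"
    and position_measurable: "\<And>i. i \<in> {1..M} \<Longrightarrow> X i \<in> borel_measurable P"
    and position: "\<And>i. i \<in> {1..M} \<Longrightarrow>
          distr P borel (X i) = uniform_measure lborel (cball 0 r_out)"
    and independent: "indep_sets (source_events P g I X) (sources M)"
begin

definition distance :: "nat \<Rightarrow> nat \<Rightarrow> 'w \<Rightarrow> real" where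
  "distance k j \<omega> = norm_dist r0 \<theta> (\<lambda>i. X i \<omega>) k j"

definition interference :: "nat \<Rightarrow> nat \<Rightarrow> 'w \<Rightarrow> real" where
  "interference k j \<omega> = of_bool (I k \<omega>) * g k j \<omega> * distance k j \<omega> powr (- \<alpha>)"

lemma receiver_eq: "receiver r0 \<theta> j = of_real r0 * cis (if j = 1 then 0 else \<theta>)"
  by (simp add: receiver_def)

lemma fading_measurable: "i \<le> M \<Longrightarrow> j \<in> {1, 2} \<Longrightarrow> g i j \<in> borel_measurable P"
  using distributed_measurable[OF fading] by simp

lemma AE_fading_nonneg:
  assumes "i \<le> M" "j \<in> {1, 2}"
  shows "AE \<omega> in P. 0 \<le> g i j \<omega>"
proof -
  note [measurable] = fading_measurable[OF assms]
  have "prob {\<omega> \<in> space P. 0 < g i j \<omega>} = 1"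
    using exponential_distributedD_gt[OF fading[OF assms], of 0] by simp
  then have "AE \<omega> in P. 0 < g i j \<omega>"
    by (subst (asm) prob_Collect_eq_1) measurable
  then show ?thesis by eventually_elim simp
qed

abbreviation "source_algebra K \<equiv> sigma (space P) (\<Union>s\<in>K. source_events P g I X s)"

lemma distance_measurable_source:
  "Position k \<in> K \<Longrightarrow> distance k j \<in> borel_measurable (source_algebra K)"
proof -
  assume "Position k \<in> K"
  then have [measurable]: "X k \<in> borel_measurable (source_algebra K)"
    by (rule measurable_sigma_sources[OF _ refl])
  show ?thesis unfolding distance_def norm_dist_def by measurable
qed

lemma fading_measurable_source:
  "Fading k j \<in> K \<Longrightarrow> g k j \<in> borel_measurable (source_algebra K)"
  by (rule measurable_sigma_sources[OF _ refl])

lemma access_measurable_source: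
  assumes "Access k \<in> K"
  shows "(\<lambda>\<omega>. of_bool (I k \<omega>) :: real) \<in> borel_measurable (source_algebra K)"
proof -
  have "I k \<in> measurable (source_algebra K) (count_space UNIV)"
    using assms by (rule measurable_sigma_sources[OF _ refl])
  then show ?thesis by (rule measurable_compose) simp
qed

lemma interference_measurable_source:
  assumes "{Fading k j, Access k, Position k} \<subseteq> K"
  shows "interference k j \<in> borel_measurable (source_algebra K)"
proof -
  have [measurable]: "g k j \<in> borel_measurable (source_algebra K)"
    "(\<lambda>\<omega>. of_bool (I k \<omega>) :: real) \<in> borel_measurable (source_algebra K)"
    "distance k j \<in> borel_measurable (source_algebra K)"
    using assms fading_measurable_source access_measurable_source distance_measurable_source by auto
  show ?thesis unfolding interference_def by measurable
qed

text \<open>The desired signal takes index 0 in the family of interference terms. One statement then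
  yields both the independence of \<open>g 0 j\<close> from their sum and the mutual independence of
  the terms.\<close>

lemma indep_vars_interference:
  assumes j: "j \<in> {1, 2}"
  shows "indep_vars (\<lambda>_. borel) (\<lambda>k. if k = 0 then g 0 j else interference k j) (insert 0 {1..M})"
proof (rule indep_vars_from_indep_sets[OF independent,
    where K = "\<lambda>k. if k = 0 then {Fading 0 j} else {Fading k j, Access k, Position k}"])
  fix k assume "k \<in> insert 0 {1..M}"
  then show "(if k = 0 then {Fading 0 j} else {Fading k j, Access k, Position k}) \<subseteq> sources M"
    using j by (auto simp: sources_def)
next
  fix k
  show "(if k = 0 then g 0 j else interference k j) \<in> borel_measurable
    (source_algebra (if k = 0 then {Fading 0 j} else {Fading k j, Access k, Position k}))"
    using fading_measurable_source[of 0 j "{Fading 0 j}"]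
      interference_measurable_source[of k j "{Fading k j, Access k, Position k}"] by simp
qed (auto simp: disjoint_family_on_def Int_stable_source_events)

lemma indep_var_sources:
  assumes "K1 \<subseteq> sources M" "K2 \<subseteq> sources M" "K1 \<inter> K2 = {}"
    and "A \<in> measurable (source_algebra K1) N1" "B \<in> measurable (source_algebra K2) N2"
  shows "indep_var N1 A N2 B"
  using indep_var_from_indep_sets[OF independent assms(1-3) Int_stable_source_events assms(4,5)] .

text \<open>The integrand is the Laplace transform of the fading at \<open>\<beta>\<close> times the
  path loss, so this is the average over the position alone: the disk integral divided by the
  area.\<close>

lemma nn_integral_laplace_distance:
  assumes k: "k \<in> {1..M}"
  shows "(\<integral>\<^sup>+\<omega>. ennreal (1 / (1 + \<beta> * distance k j \<omega> powr (- \<alpha>))) \<partial>P) =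
    ennreal (T_avg \<alpha> \<beta> r_out r0)"
proof -
  note [measurable] = position_measurable[OF k]
  let ?h = "\<lambda>z. ennreal (1 / (1 + \<beta> * (cmod (z - receiver r0 \<theta> j) / r0) powr (- \<alpha>)))"
  have area: "0 < region_area r_out" using r0 by (simp add: region_area_def)
  have "(\<integral>\<^sup>+\<omega>. ennreal (1 / (1 + \<beta> * distance k j \<omega> powr (- \<alpha>))) \<partial>P) = (\<integral>\<^sup>+\<omega>. ?h (X k \<omega>) \<partial>P)"
    by (simp add: distance_def norm_dist_def)
  also have "\<dots> = (\<integral>\<^sup>+z. ?h z \<partial>uniform_measure lborel (cball 0 r_out))"
    unfolding position[OF k, symmetric] by (rule nn_integral_distr[symmetric]) measurable
  also have "\<dots> = (\<integral>\<^sup>+z. indicator (cball 0 r_out) z * ?h z \<partial>lborel) / emeasure lborel (cball (0::complex) r_out)"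
    by (subst nn_integral_uniform_measure) (simp_all add: mult.commute)
  also have "(\<integral>\<^sup>+z. indicator (cball 0 r_out) z * ?h z \<partial>lborel) = ennreal (region_area r_out * T_avg \<alpha> \<beta> r_out r0)"
    unfolding receiver_eq by (rule nn_integral_disk_eq_T_avg(1)[OF \<alpha> \<beta> r0])
  also have "emeasure lborel (cball (0::complex) r_out) = ennreal (region_area r_out)"
    using r0 by (simp add: emeasure_cball unit_ball_vol_2 region_area_def)
  finally show ?thesis
    using area nn_integral_disk_eq_T_avg(2)[OF \<alpha> \<beta> r0] by (simp add: divide_ennreal)
qed

lemma nn_integral_laplace_fading:
  assumes k: "k \<in> {1..M}" and j: "j \<in> {1, 2}"
  shows "(\<integral>\<^sup>+\<omega>. ennreal (exp (- (\<beta> * distance k j \<omega> powr (- \<alpha>) * g k j \<omega>))) \<partial>P) =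
    ennreal (T_avg \<alpha> \<beta> r_out r0)"
proof -
  have indep: "indep_var borel (g k j) borel (distance k j)"
  proof (rule indep_var_sources)
    show "{Fading k j} \<subseteq> sources M" "{Position k} \<subseteq> sources M"
      using k j by (auto simp: sources_def)
    show "g k j \<in> borel_measurable (source_algebra {Fading k j})"
      by (rule fading_measurable_source) simp
    show "distance k j \<in> borel_measurable (source_algebra {Position k})"
      by (rule distance_measurable_source) simp
  qed simp
  have "(\<integral>\<^sup>+\<omega>. ennreal (exp (- (\<beta> * distance k j \<omega> powr (- \<alpha>) * g k j \<omega>))) \<partial>P) =
    (\<integral>\<^sup>+\<omega>. (\<integral>\<^sup>+\<omega>'. ennreal (exp (- (\<beta> * distance k j \<omega> powr (- \<alpha>) * g k j \<omega>'))) \<partial>P) \<partial>P)"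
    using nn_integral_indep_var[OF indep, of "\<lambda>w. ennreal (exp (- (\<beta> * snd w powr (- \<alpha>) * fst w)))"]
    by simp
  also have "\<dots> = (\<integral>\<^sup>+\<omega>. ennreal (1 / (1 + \<beta> * distance k j \<omega> powr (- \<alpha>))) \<partial>P)"
    using k j \<beta> by (intro nn_integral_cong nn_integral_exponential_laplace fading) auto
  finally show ?thesis using nn_integral_laplace_distance[OF k] by simp
qed

lemma nn_integral_laplace_interference:
  assumes k: "k \<in> {1..M}" and j: "j \<in> {1, 2}"
  shows "(\<integral>\<^sup>+\<omega>. ennreal (exp (- (\<beta> * interference k j \<omega>))) \<partial>P) =
    ennreal (1 - p + p * T_avg \<alpha> \<beta> r_out r0)"
proof -
  define V where "V = (\<lambda>\<omega>. exp (- (\<beta> * distance k j \<omega> powr (- \<alpha>) * g k j \<omega>)))"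
  define A where "A = (\<lambda>\<omega>. of_bool (I k \<omega>) :: real)"
  note [measurable] = access_measurable[OF k]
  have V_source: "V \<in> borel_measurable (source_algebra {Fading k j, Position k})"
  proof -
    have [measurable]: "g k j \<in> borel_measurable (source_algebra {Fading k j, Position k})"
      "distance k j \<in> borel_measurable (source_algebra {Fading k j, Position k})"
      by (rule fading_measurable_source distance_measurable_source; simp)+
    show ?thesis unfolding V_def by measurable
  qed
  have indep: "indep_var borel A borel V"
  proof (rule indep_var_sources[OF _ _ _ _ V_source])
    show "{Access k} \<subseteq> sources M" "{Fading k j, Position k} \<subseteq> sources M"
      using k j by (auto simp: sources_def)
    show "A \<in> borel_measurable (source_algebra {Access k})"
      unfolding A_def by (rule access_measurable_source) simp
  qed simp
  note [measurable] = indep_var_rv1[OF indep] indep_var_rv2[OF indep]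
  have bern: "(\<integral>\<^sup>+\<omega>. f (I k \<omega>) \<partial>P) = f True * ennreal p + f False * ennreal (1 - p)" for f :: "bool \<Rightarrow> ennreal"
  proof -
    have "(\<integral>\<^sup>+\<omega>. f (I k \<omega>) \<partial>P) = (\<integral>\<^sup>+b. f b \<partial>distr P (count_space UNIV) (I k))"
      by (rule nn_integral_distr[symmetric]) measurable
    then show ?thesis unfolding access[OF k] using p by simp
  qed
  \<comment> \<open>Since the access indicator is 0 or 1, the exponential interpolates linearly
    between 1 and \<open>V\<close>; independence of access from fading and position then splits the
    second term.\<close>
  have "(\<integral>\<^sup>+\<omega>. ennreal (exp (- (\<beta> * interference k j \<omega>))) \<partial>P) =
    (\<integral>\<^sup>+\<omega>. ennreal (1 - A \<omega>) + ennreal (A \<omega>) * ennreal (V \<omega>) \<partial>P)"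
    by (intro nn_integral_cong) (auto simp: interference_def A_def V_def mult_ac)
  also have "\<dots> = (\<integral>\<^sup>+\<omega>. ennreal (1 - A \<omega>) \<partial>P) + (\<integral>\<^sup>+\<omega>. ennreal (A \<omega>) * ennreal (V \<omega>) \<partial>P)"
    by (rule nn_integral_add) measurable
  also have "(\<integral>\<^sup>+\<omega>. ennreal (1 - A \<omega>) \<partial>P) = ennreal (1 - p)"
    unfolding A_def using bern[of "\<lambda>b. ennreal (1 - of_bool b)"] by simp
  also have "(\<integral>\<^sup>+\<omega>. ennreal (A \<omega>) * ennreal (V \<omega>) \<partial>P) =
    (\<integral>\<^sup>+\<omega>. (\<integral>\<^sup>+\<omega>'. ennreal (A \<omega>') * ennreal (V \<omega>) \<partial>P) \<partial>P)"
    using nn_integral_indep_var[OF indep, of "\<lambda>w. ennreal (fst w) * ennreal (snd w)"] by simp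
  also have "\<dots> = (\<integral>\<^sup>+\<omega>. ennreal p * ennreal (V \<omega>) \<partial>P)"
    unfolding A_def using bern[of "\<lambda>b. ennreal (of_bool b) * _"]
    by (intro nn_integral_cong) (simp add: mult.commute)
  also have "\<dots> = ennreal p * ennreal (T_avg \<alpha> \<beta> r_out r0)"
  proof -
    have "(\<integral>\<^sup>+\<omega>. ennreal (V \<omega>) \<partial>P) = ennreal (T_avg \<alpha> \<beta> r_out r0)"
      unfolding V_def by (rule nn_integral_laplace_fading[OF k j])
    then show ?thesis by (simp add: nn_integral_cmult)
  qed
  also have "ennreal (1 - p) + \<dots> = ennreal (1 - p + p * T_avg \<alpha> \<beta> r_out r0)"
    using p nn_integral_disk_eq_T_avg(2)[OF \<alpha> \<beta> r0] by (simp add: ennreal_mult)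
  finally show ?thesis .
qed

lemma prob_outage:
  assumes j: "j \<in> {1, 2}"
  shows "outage P \<alpha> \<beta> SNR M r0 \<theta> g I X j \<in> events"
    and "prob (outage P \<alpha> \<beta> SNR M r0 \<theta> g I X j) =
      1 - exp (- (\<beta> / SNR)) * (1 - p + p * T_avg \<alpha> \<beta> r_out r0) ^ M"
proof -
  let ?T = "T_avg \<alpha> \<beta> r_out r0"
  define S where "S = (\<lambda>\<omega>. \<Sum>k\<in>{1..M}. interference k j \<omega>)"
  \<comment> \<open>The level that the desired signal must exceed to avoid outage; exp(-B) splits
    into a noise factor and one factor per interferer.\<close>
  define B where "B = (\<lambda>\<omega>. \<beta> * (1 / SNR + S \<omega>))"
  have outage_eq: "outage P \<alpha> \<beta> SNR M r0 \<theta> g I X j =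
    {\<omega> \<in> space P. g 0 j \<omega> / (1 / SNR + S \<omega>) \<le> \<beta>}"
    by (simp add: outage_def sinr_def S_def interference_def distance_def)
  have indep_S: "indep_var borel (g 0 j) borel S"
  proof -
    have "S = (\<lambda>\<omega>. \<Sum>k\<in>{1..M}. (if k = 0 then g 0 j else interference k j) \<omega>)"
      unfolding S_def by (intro ext sum.cong) auto
    then show ?thesis
      using indep_vars_sum[OF _ _ indep_vars_interference[OF j]] by simp
  qed
  from indep_var_compose[OF this, of "\<lambda>x. x" borel "\<lambda>s. \<beta> * (1 / SNR + s)" borel]
  have indep_B: "indep_var borel (g 0 j) borel B"
    unfolding B_def by (simp add: comp_def)
  note [measurable] = indep_var_rv1[OF indep_S] indep_var_rv2[OF indep_S] indep_var_rv2[OF indep_B]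
  show events: "outage P \<alpha> \<beta> SNR M r0 \<theta> g I X j \<in> events"
    unfolding outage_eq by measurable
  have "AE \<omega> in P. \<forall>k\<in>{1..M}. 0 \<le> g k j \<omega>"
    using AE_fading_nonneg j by (intro AE_finite_allI) auto
  \<comment> \<open>The fading is nonnegative only almost surely. Off a null set the denominator of
    the SINR is therefore positive, so that clearing it keeps the direction of the
    inequality.\<close>
  then have S_nonneg: "AE \<omega> in P. 0 \<le> S \<omega>"
    by eventually_elim (auto simp: S_def interference_def intro!: sum_nonneg)
  have indep: "indep_vars (\<lambda>_. borel) (\<lambda>k. interference k j) {1..M}"
    using indep_vars_subset[OF indep_vars_interference[OF j], of "{1..M}"]
    by (subst indep_vars_cong[OF refl, where Y = "\<lambda>k. if k = 0 then g 0 j else interference k j"]) auto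
  have "emeasure P {\<omega> \<in> space P. B \<omega> < g 0 j \<omega>} = (\<integral>\<^sup>+\<omega>. ennreal (exp (- B \<omega>)) \<partial>P)"
    using S_nonneg \<beta> SNR j
    by (intro emeasure_exponential_gt_indep[OF indep_B] fading) (auto simp: B_def elim: eventually_mono)
  also have "\<dots> = (\<integral>\<^sup>+\<omega>. ennreal (exp (- (\<beta> / SNR))) *
      (\<Prod>k\<in>{1..M}. ennreal (exp (- (\<beta> * interference k j \<omega>)))) \<partial>P)"
  proof (rule nn_integral_cong)
    fix \<omega>
    have "exp (- B \<omega>) = exp (- (\<beta> / SNR)) * exp (\<Sum>k\<in>{1..M}. - (\<beta> * interference k j \<omega>))"
      unfolding exp_add[symmetric] by (simp add: B_def S_def sum_negf sum_distrib_left distrib_left)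
    then show "ennreal (exp (- B \<omega>)) = ennreal (exp (- (\<beta> / SNR))) *
      (\<Prod>k\<in>{1..M}. ennreal (exp (- (\<beta> * interference k j \<omega>))))"
      by (simp add: exp_sum prod_ennreal ennreal_mult prod_nonneg)
  qed
  also have "\<dots> = ennreal (exp (- (\<beta> / SNR))) *
      (\<integral>\<^sup>+\<omega>. (\<Prod>k\<in>{1..M}. ennreal (exp (- (\<beta> * interference k j \<omega>)))) \<partial>P)"
  proof (intro nn_integral_cmult borel_measurable_prod_ennreal)
    fix k assume "k \<in> {1..M}"
    then have [measurable]: "interference k j \<in> borel_measurable P"
      using indep by (simp add: indep_vars_def)
    show "(\<lambda>\<omega>. ennreal (exp (- (\<beta> * interference k j \<omega>)))) \<in> borel_measurable P"
      by measurable
  qed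
  also have "(\<integral>\<^sup>+\<omega>. (\<Prod>k\<in>{1..M}. ennreal (exp (- (\<beta> * interference k j \<omega>)))) \<partial>P) =
      (\<Prod>k\<in>{1..M}. \<integral>\<^sup>+\<omega>. ennreal (exp (- (\<beta> * interference k j \<omega>))) \<partial>P)"
  proof (rule indep_vars_nn_integral)
    show "indep_vars (\<lambda>_. borel) (\<lambda>k \<omega>. ennreal (exp (- (\<beta> * interference k j \<omega>)))) {1..M}"
      by (rule indep_vars_compose2[OF indep, where Y = "\<lambda>_ x. ennreal (exp (- (\<beta> * x)))"]) measurable
  qed simp_all
  also have "\<dots> = (\<Prod>k\<in>{1..M}. ennreal (1 - p + p * ?T))"
    using nn_integral_laplace_interference[OF _ j] by (intro prod.cong) auto
  also have "ennreal (exp (- (\<beta> / SNR))) * \<dots> = ennreal (exp (- (\<beta> / SNR)) * (1 - p + p * ?T) ^ M)"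
    using p nn_integral_disk_eq_T_avg(2)[OF \<alpha> \<beta> r0] by (simp add: ennreal_mult ennreal_power del: ennreal_plus)
  finally have "prob {\<omega> \<in> space P. B \<omega> < g 0 j \<omega>} = exp (- (\<beta> / SNR)) * (1 - p + p * ?T) ^ M"
    using p nn_integral_disk_eq_T_avg(2)[OF \<alpha> \<beta> r0] by (simp add: measure_def)
  moreover have "prob (outage P \<alpha> \<beta> SNR M r0 \<theta> g I X j) = prob {\<omega> \<in> space P. \<not> B \<omega> < g 0 j \<omega>}"
  proof (rule finite_measure_eq_AE)
    show "AE \<omega> in P. \<omega> \<in> outage P \<alpha> \<beta> SNR M r0 \<theta> g I X j \<longleftrightarrow> \<omega> \<in> {\<omega> \<in> space P. \<not> B \<omega> < g 0 j \<omega>}"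
      using S_nonneg
    proof eventually_elim
      fix \<omega> assume "0 \<le> S \<omega>"
      then have "0 < 1 / SNR + S \<omega>" using SNR by (simp add: add_pos_nonneg)
      then show "\<omega> \<in> outage P \<alpha> \<beta> SNR M r0 \<theta> g I X j \<longleftrightarrow> \<omega> \<in> {\<omega> \<in> space P. \<not> B \<omega> < g 0 j \<omega>}"
        by (simp add: outage_eq B_def pos_divide_le_eq not_less mult.commute)
    qed
  qed (use events in measurable)
  moreover have "prob {\<omega> \<in> space P. \<not> B \<omega> < g 0 j \<omega>} = 1 - prob {\<omega> \<in> space P. B \<omega> < g 0 j \<omega>}"
    by (rule prob_neg) measurable
  ultimately show "prob (outage P \<alpha> \<beta> SNR M r0 \<theta> g I X j) =
      1 - exp (- (\<beta> / SNR)) * (1 - p + p * ?T) ^ M"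
    by simp
qed

lemma subalgebra_distance_algebra: "subalgebra P (distance_algebra P M r0 \<theta> X)"
proof -
  let ?N = "\<Pi>\<^sub>M k \<in> {1..M} \<times> {1, 2::nat}. (borel :: real measure)"
  have "(\<lambda>\<omega>. \<lambda>(i, j) \<in> {1..M} \<times> {1, 2}. norm_dist r0 \<theta> (\<lambda>k. X k \<omega>) i j) \<in> measurable P ?N"
  proof (rule measurable_restrict)
    fix ij :: "nat \<times> nat" assume "ij \<in> {1..M} \<times> {1, 2}"
    then have [measurable]: "X (fst ij) \<in> borel_measurable P"
      using position_measurable by auto
    show "(\<lambda>\<omega>. case ij of (i, j) \<Rightarrow> norm_dist r0 \<theta> (\<lambda>k. X k \<omega>) i j) \<in> borel_measurable P"
      unfolding case_prod_unfold norm_dist_def by measurable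
  qed
  then show ?thesis
    unfolding distance_algebra_def subalgebra_def measurable_iff_sets by simp
qed

lemma expectation_cond_outage_prob:
  assumes "j \<in> {1, 2}"
  shows "expectation (cond_outage_prob P \<alpha> \<beta> SNR M r0 \<theta> g I X j) =
    1 - exp (- (\<beta> / SNR)) * (1 - p + p * T_avg \<alpha> \<beta> r_out r0) ^ M"
proof -
  interpret D: finite_measure_subalgebra P "distance_algebra P M r0 \<theta> X"
    by unfold_locales (rule subalgebra_distance_algebra)
  have "integrable P (indicator (outage P \<alpha> \<beta> SNR M r0 \<theta> g I X j) :: 'w \<Rightarrow> real)"
    using prob_outage(1)[OF assms] by (simp add: integrable_real_indicator less_top[symmetric])
  from D.real_cond_exp_int(2)[OF this] show ?thesis
    using prob_outage[OF assms] by (simp add: cond_outage_prob_def)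
qed

end

theorem theorem1:
  fixes P :: "'w measure"
    and g :: "nat \<Rightarrow> nat \<Rightarrow> 'w \<Rightarrow> real"
    and I :: "nat \<Rightarrow> 'w \<Rightarrow> bool"
    and X :: "nat \<Rightarrow> 'w \<Rightarrow> complex"
    and M :: nat
    and \<alpha> \<beta> SNR r0 r_out \<theta> p :: real
  assumes "prob_space P"
    and "\<alpha> > 0" and "\<beta> > 0" and "SNR > 0"
    and "0 < r0" and "r0 \<le> r_out"
    and "0 \<le> p" and "p \<le> 1"
    and fading: "\<And>i j. i \<le> M \<Longrightarrow> j \<in> {1, 2} \<Longrightarrow>
          distributed P lborel (g i j) (exponential_density 1)"
    and access_measurable: "\<And>i. i \<in> {1..M} \<Longrightarrow> I i \<in> measurable P (count_space UNIV)"
    and access: "\<And>i. i \<in> {1..M} \<Longrightarrow>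
          distr P (count_space UNIV) (I i) = measure_pmf (bernoulli_pmf p)"
    and position_measurable: "\<And>i. i \<in> {1..M} \<Longrightarrow> X i \<in> borel_measurable P"
    and position: "\<And>i. i \<in> {1..M} \<Longrightarrow>
          distr P borel (X i) = uniform_measure lborel (cball 0 r_out)"
    and independent: "prob_space.indep_sets P (source_events P g I X) (sources M)"
  shows "(\<forall>j \<in> {1, 2}.
            prob_space.expectation P (cond_outage_prob P \<alpha> \<beta> SNR M r0 \<theta> g I X j)
              = 1 - exp (- (\<beta> / SNR)) * (1 - p + p * T_avg \<alpha> \<beta> r_out r0) ^ M)
       \<and> (\<forall>x \<ge> 0. complex_of_real (Psi \<alpha> \<beta> x)
              = of_real (x powr (\<alpha> + 2) / (2 + \<alpha>))
                * hyp2F1 1 (of_real (2 / \<alpha> + 1)) (of_real (2 / \<alpha> + 2))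
                    (of_real (- (x powr \<alpha>) / \<beta>)))"
proof -
  interpret rayleigh_network P g I X M \<alpha> \<beta> SNR r0 r_out \<theta> p
    using assms by (intro rayleigh_network.intro rayleigh_network_axioms.intro) auto
  show ?thesis
    using expectation_cond_outage_prob Psi_eq_hyp2F1[OF \<open>0 < \<alpha>\<close> \<open>0 < \<beta>\<close>] by blast
qed

end
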